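(* Consider the LQG co-design setting given in the context. For any active sensor set $\mathcal{S}$, let $\hat{x}_t(\mathcal{S})$ be the Kalman estimator of the state $x_t$, and $\Sigma_{t|t}(\mathcal{S})$ be $\hat{x}_t(\mathcal{S})$'s error covariance. Additionally, let the matrices $\Theta_t$ and $K_t$ be the solution of the backward Riccati recursion $$S_t=Q_t+N_{t+1},\quad N_t=A_t^{\mathsf T}(S_t^{-1}+B_tR_t^{-1}B_t^{\mathsf T})^{-1}A_t,\quad M_t=B_t^{\mathsf T}S_tB_t+R_t,\quad K_t=-M_t^{-1}B_t^{\mathsf T}S_tA_t,\quad \Theta_t=K_t^{\mathsf T}M_tK_t,$$ with boundary condition $N_{T+1}=0$. (1) (Separability in Problem 1.) Any optimal solution $(\mathcal{S}^\star,u^\star_{1:T})$ to Problem 1 can be computed in cascade: $$\mathcal{S}^\star\in\operatorname*{arg\,min}_{\mathcal{S}\subseteq\mathcal{V}}\ \sum_{t=1}^T\mathrm{tr}[\Theta_t\Sigma_{t|t}(\mathcal{S})]\quad\text{s.t. } c(\mathcal{S})\le b,$$ $$u_t^\star=K_t\hat{x}_t(\mathcal{S}^\star),\quad t=1,\ldots,T.$$ (2) (Separability in Problem 2.) Define the constant $\bar\kappa=\kappa-\mathrm{tr}(\Sigma_{1|1}N_1)-\sum_{t=1}^T\mathrm{tr}(W_tS_t)$. Any optimal solution $(\mathcal{S}^\star,u^\star_{1:T})$ to Problem 2 can be computed in cascade: $$\mathcal{S}^\star\in\operatorname*{arg\,min}_{\mathcal{S}\subseteq\mathcal{V}}\ c(\mathcal{S})\quad\text{s.t.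 }\sum_{t=1}^T\mathrm{tr}[\Theta_t\Sigma_{t|t}(\mathcal{S})]\le\bar\kappa,$$ $$u_t^\star=K_t\hat{x}_t(\mathcal{S}^\star),\quad t=1,\ldots,T.$$
   Context: System: $x_{t+1}=A_tx_t+B_tu_t+w_t$, $t=1,\ldots,T$, with state $x_t\in\mathbb{R}^n$, control $u_t\in\mathbb{R}^{m_t}$, process noise $w_t$, known matrices $A_t,B_t$, and finite horizon $T$. $x_1$ is a Gaussian random variable with covariance $\Sigma_{1|1}$ (written without argument); $w_t$ is Gaussian with mean zero and covariance $W_t$, and is independent of $x_1$ and of $w_{t'}$ for all $t'\ne t$. Sensors: $\mathcal{V}$ is a finite set of sensors; sensor $i\in\mathcal{V}$ gives $y_{i,t}=C_{i,t}x_t+v_{i,t}$, with $C_{i,t}$ a sensing matrix and $v_{i,t}$ Gaussian with mean zero and positive definite covariance $V_{i,t}$, such that $v_{i,t}$ is independent of $x_1$, of $w_{t'}$ for any $t'\ne t$, and of $v_{i',t'}$ for all $t'\ne t$ and any $i'\in\mathcal{V}$, $i'\ne i$. When the subset $\mathcal{S}\subseteq\mathcal{V}$ is active (for all $t$), $y_t(\mathcal{S})$ stacks the $y_{i,t}$, $i\in\mathcal{S}$. Sensor $i$ has cost $c(i)\ge 0$, and $c(\mathcal{S})=\sum_{i\in\mathcal{S}}c(i)$. Policies: $u_{1:T}(\mathcal{S})=\{u_1(\mathcal{S}),\ldots,u_T(\mathcal{S})\}$, where $u_t(\mathcal{S})$ is a function of $y_1(\mathcal{S}),\ldots,y_t(\mathcal{S})$.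 LQG cost: $h(\mathcal{S},u_{1:T}(\mathcal{S}))=\sum_{t=1}^T\mathbb{E}[\|x_{t+1}(\mathcal{S})\|^2_{Q_t}+\|u_t(\mathcal{S})\|^2_{R_t}]$, where $\|z\|_Q^2=z^{\mathsf T}Qz$, the $Q_t$ are known positive semidefinite matrices, the $R_t$ are known positive definite matrices, $x_{t}(\mathcal{S})$ is the state under the policy $u_{1:T}(\mathcal{S})$, and the expectation is over $x_1$, the process noises and the measurement noises of $\mathcal{S}$. Problem 1 (sensing-constrained LQG control): given a budget $b\ge0$, minimize $h(\mathcal{S},u_{1:T}(\mathcal{S}))$ over $\mathcal{S}\subseteq\mathcal{V}$ and $u_{1:T}(\mathcal{S})$, subject to $c(\mathcal{S})\le b$. Problem 2 (minimum-sensing LQG control): given $\kappa\ge0$, minimize $c(\mathcal{S})$ over $\mathcal{S}\subseteq\mathcal{V}$ and $u_{1:T}(\mathcal{S})$, subject to $h(\mathcal{S},u_{1:T}(\mathcal{S}))\le\kappa$. Kalman estimator: $\hat{x}_t(\mathcal{S})=\mathbb{E}[x_t\mid y_1(\mathcal{S}),\ldots,y_t(\mathcal{S})]$, with error covariance $\Sigma_{t|t}(\mathcal{S})=\mathbb{E}[(x_t-\hat{x}_t(\mathcal{S}))(x_t-\hat{x}_t(\mathcal{S}))^{\mathsf T}]$.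
   Formalization: Repairs: x_1, the w_t and the block of all measurement noises are mutually independent (so v_{i,t} also of w_t); in (2) x_1 has mean zero; in (2) u*_t = K_t x̂_t is claimed only if u* also minimizes h(S*,·), as slack in κ admits other optimal policies. *)

theory Defs
  imports "HOL-Probability.Probability" "Jordan_Normal_Form.Gauss_Jordan_Elimination"
begin

unbundle no vec_syntax
unbundle no inner_syntax

text \<open>
  The dimensions of the controls and of the measurements vary with time and with the sensor, so
  vectors and matrices are those of \<^theory>\<open>Jordan_Normal_Form.Matrix\<close>, with their dimensions given
  by carrier sets.
\<close>

section \<open>Matrices\<close>

definition quad :: "real mat \<Rightarrow> real vec \<Rightarrow> real" where
  "quad A z = scalar_prod z (A *\<^sub>v z)"

definition pos_semidef :: "nat \<Rightarrow> real mat \<Rightarrow> bool" where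
  "pos_semidef n A \<longleftrightarrow>
     A \<in> carrier_mat n n \<and> A\<^sup>T = A \<and> (\<forall>z \<in> carrier_vec n. 0 \<le> quad A z)"

definition pos_def :: "nat \<Rightarrow> real mat \<Rightarrow> bool" where
  "pos_def n A \<longleftrightarrow>
     A \<in> carrier_mat n n \<and> A\<^sup>T = A \<and> (\<forall>z \<in> carrier_vec n. z \<noteq> 0\<^sub>v n \<longrightarrow> 0 < quad A z)"

definition tr :: "real mat \<Rightarrow> real" where
  "tr A = (\<Sum>i<dim_row A. A $$ (i, i))"

text \<open>Meaningful for invertible \<open>A\<close> only.\<close>

definition minv :: "real mat \<Rightarrow> real mat" where
  "minv A = the (mat_inverse A)"

section \<open>Random vectors\<close>

text \<open>The Borel sets of \<open>\<real>\<^sup>n\<close>, transported along the coordinates.\<close>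

definition borel_vec :: "nat \<Rightarrow> real vec measure" where
  "borel_vec n =
     vimage_algebra (carrier_vec n) (\<lambda>z. \<lambda>j\<in>{..<n}. z $ j) (PiM {..<n} (\<lambda>_. borel))"

text \<open>A Gaussian with variance \<open>0\<close> is almost surely constant.\<close>

definition gaussian_real :: "'w measure \<Rightarrow> ('w \<Rightarrow> real) \<Rightarrow> real \<Rightarrow> real \<Rightarrow> bool" where
  "gaussian_real M X \<mu> s2 \<longleftrightarrow>
     X \<in> borel_measurable M \<and>
     (if s2 = 0 then (AE \<omega> in M. X \<omega> = \<mu>)
      else s2 > 0 \<and> distributed M lborel X (\<lambda>x. ennreal (normal_density \<mu> (sqrt s2) x)))"

text \<open>
  A random vector is Gaussian if all its linear functionals are; this admits singular covariances.
\<close>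

definition gaussian_vec ::
    "'w measure \<Rightarrow> nat \<Rightarrow> ('w \<Rightarrow> real vec) \<Rightarrow> real vec \<Rightarrow> real mat \<Rightarrow> bool" where
  "gaussian_vec M n X \<mu> \<Sigma> \<longleftrightarrow>
     X \<in> measurable M (borel_vec n) \<and> \<mu> \<in> carrier_vec n \<and> pos_semidef n \<Sigma> \<and>
     (\<forall>a \<in> carrier_vec n.
        gaussian_real M (\<lambda>\<omega>. scalar_prod a (X \<omega>)) (scalar_prod a \<mu>) (quad \<Sigma> a))"

definition events_of :: "'w measure \<Rightarrow> ('w \<Rightarrow> 'b) \<Rightarrow> 'b measure \<Rightarrow> 'w set set" where
  "events_of M X N = sets (vimage_algebra (space M) X N)"

section \<open>The system and its sensors\<close>

record ('w, 'i) lqg =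
  prob_sp :: "'w measure"
  horizon :: nat
  dimx :: nat
  dimu :: "nat \<Rightarrow> nat"
  sensors :: "'i set"
  dimy :: "'i \<Rightarrow> nat \<Rightarrow> nat"
  sys_A :: "nat \<Rightarrow> real mat"
  sys_B :: "nat \<Rightarrow> real mat"
  sens_C :: "'i \<Rightarrow> nat \<Rightarrow> real mat"
  init_x :: "'w \<Rightarrow> real vec"
  proc_w :: "nat \<Rightarrow> 'w \<Rightarrow> real vec"
  meas_v :: "'i \<Rightarrow> nat \<Rightarrow> 'w \<Rightarrow> real vec"
  init_mean :: "real vec"
  init_cov :: "real mat"
  proc_cov :: "nat \<Rightarrow> real mat"
  meas_cov :: "'i \<Rightarrow> nat \<Rightarrow> real mat"
  wt_Q :: "nat \<Rightarrow> real mat"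
  wt_R :: "nat \<Rightarrow> real mat"
  sens_cost :: "'i \<Rightarrow> real"

text \<open>
  \<open>obs_space G S t\<close> is the space of the histories \<open>(y\<^sub>1(S), \<dots>, y\<^sub>t(S))\<close>, where the stacked vector
  \<open>y\<^sub>s(S)\<close> is the family of the readings at time \<open>s\<close>, indexed by the active sensors.
\<close>

definition obs_space :: "('w, 'i) lqg \<Rightarrow> 'i set \<Rightarrow> nat \<Rightarrow> (nat \<Rightarrow> 'i \<Rightarrow> real vec) measure" where
  "obs_space G S t = PiM {1..t} (\<lambda>s. PiM S (\<lambda>i. borel_vec (dimy G i s)))"

text \<open>
  The initial state, the process noises and the measurement noises are mutually independent, the
  measurement noises entering as a single block. Within this block only independence for distinct
  sensors at distinct times is required; readings taken at the same time may have dependent noises,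
  and so may readings of one sensor.
\<close>

datatype source = Init | Proc nat | Meas

primrec source_events :: "('w, 'i) lqg \<Rightarrow> source \<Rightarrow> 'w set set" where
  "source_events G Init = events_of (prob_sp G) (init_x G) (borel_vec (dimx G))"
| "source_events G (Proc t) = events_of (prob_sp G) (proc_w G t) (borel_vec (dimx G))"
| "source_events G Meas =
     events_of (prob_sp G) (\<lambda>\<omega>. \<lambda>t\<in>{1..horizon G}. \<lambda>i\<in>sensors G. meas_v G i t \<omega>)
       (obs_space G (sensors G) (horizon G))"

definition lqg_setting :: "('w, 'i) lqg \<Rightarrow> bool" where
  "lqg_setting G \<longleftrightarrow>
     prob_space (prob_sp G) \<and>
     finite (sensors G) \<and>
     (\<forall>i \<in> sensors G. 0 \<le> sens_cost G i) \<and>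
     (\<forall>t \<in> {1..horizon G}.
        sys_A G t \<in> carrier_mat (dimx G) (dimx G) \<and>
        sys_B G t \<in> carrier_mat (dimx G) (dimu G t) \<and>
        pos_semidef (dimx G) (wt_Q G t) \<and>
        pos_def (dimu G t) (wt_R G t) \<and>
        gaussian_vec (prob_sp G) (dimx G) (proc_w G t) (0\<^sub>v (dimx G)) (proc_cov G t)) \<and>
     (\<forall>i \<in> sensors G. \<forall>t \<in> {1..horizon G}.
        sens_C G i t \<in> carrier_mat (dimy G i t) (dimx G) \<and>
        pos_def (dimy G i t) (meas_cov G i t) \<and>
        gaussian_vec (prob_sp G) (dimy G i t) (meas_v G i t) (0\<^sub>v (dimy G i t)) (meas_cov G i t)) \<and>
     gaussian_vec (prob_sp G) (dimx G) (init_x G) (init_mean G) (init_cov G) \<and>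
     prob_space.indep_sets (prob_sp G) (source_events G) ({Init, Meas} \<union> Proc ` {1..horizon G}) \<and>
     (\<forall>i \<in> sensors G. \<forall>i' \<in> sensors G. \<forall>t \<in> {1..horizon G}. \<forall>t' \<in> {1..horizon G}.
        i \<noteq> i' \<longrightarrow> t \<noteq> t' \<longrightarrow>
        prob_space.indep_var (prob_sp G) (borel_vec (dimy G i t)) (meas_v G i t)
          (borel_vec (dimy G i' t')) (meas_v G i' t'))"

section \<open>Policies and the closed loop\<close>

type_synonym 'i policy = "nat \<Rightarrow> (nat \<Rightarrow> 'i \<Rightarrow> real vec) \<Rightarrow> real vec"

definition is_policy :: "('w, 'i) lqg \<Rightarrow> 'i set \<Rightarrow> 'i policy \<Rightarrow> bool" where
  "is_policy G S u \<longleftrightarrow>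
     (\<forall>t \<in> {1..horizon G}. u t \<in> measurable (obs_space G S t) (borel_vec (dimu G t)))"

lemma restrict_fundef_cong [fundef_cong]:
  "I = J \<Longrightarrow> (\<And>i. i \<in> J \<Longrightarrow> f i = g i) \<Longrightarrow> restrict f I = restrict g J"
  by (auto simp: restrict_def fun_eq_iff)

text \<open>Times start at \<open>1\<close>; the value at time \<open>0\<close> is immaterial.\<close>

function state :: "('w, 'i) lqg \<Rightarrow> 'i set \<Rightarrow> 'i policy \<Rightarrow> nat \<Rightarrow> 'w \<Rightarrow> real vec" where
  "state G S u t \<omega> =
     (if t \<le> 1 then init_x G \<omega>
      else sys_A G (t - 1) *\<^sub>v state G S u (t - 1) \<omega>
         + sys_B G (t - 1) *\<^sub>v u (t - 1)
             (\<lambda>s\<in>{1..t - 1}. \<lambda>i\<in>S. sens_C G i s *\<^sub>v state G S u s \<omega> + meas_v G i s \<omega>)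
         + proc_w G (t - 1) \<omega>)"
  by pat_completeness auto
termination
  by (relation "Wellfounded.measure (\<lambda>(G, S, u, t, \<omega>). t)") auto

declare state.simps [simp del]

definition reading ::
    "('w, 'i) lqg \<Rightarrow> 'i set \<Rightarrow> 'i policy \<Rightarrow> 'i \<Rightarrow> nat \<Rightarrow> 'w \<Rightarrow> real vec" where
  "reading G S u i t \<omega> = sens_C G i t *\<^sub>v state G S u t \<omega> + meas_v G i t \<omega>"

definition history ::
    "('w, 'i) lqg \<Rightarrow> 'i set \<Rightarrow> 'i policy \<Rightarrow> nat \<Rightarrow> 'w \<Rightarrow> nat \<Rightarrow> 'i \<Rightarrow> real vec" where
  "history G S u t \<omega> = (\<lambda>s\<in>{1..t}. \<lambda>i\<in>S. reading G S u i s \<omega>)"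

definition control :: "('w, 'i) lqg \<Rightarrow> 'i set \<Rightarrow> 'i policy \<Rightarrow> nat \<Rightarrow> 'w \<Rightarrow> real vec" where
  "control G S u t \<omega> = u t (history G S u t \<omega>)"

lemma state_1: "state G S u 1 \<omega> = init_x G \<omega>"
  by (subst state.simps) simp

lemma state_Suc:
  assumes "1 \<le> t"
  shows "state G S u (t + 1) \<omega> =
    sys_A G t *\<^sub>v state G S u t \<omega> + sys_B G t *\<^sub>v control G S u t \<omega> + proc_w G t \<omega>"
  using assms by (subst state.simps) (simp add: control_def history_def reading_def)

text \<open>
  The expected cost is a Lebesgue integral of nonnegative functions with values in \<open>[0, \<infinity>]\<close>, so it
  is defined for every policy, integrable or not.
\<close>

definition lqg_cost :: "('w, 'i) lqg \<Rightarrow> 'i set \<Rightarrow> 'i policy \<Rightarrow> ennreal" where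
  "lqg_cost G S u =
     (\<Sum>t=1..horizon G.
        \<integral>\<^sup>+ \<omega>. ennreal (quad (wt_Q G t) (state G S u (t + 1) \<omega>)
                     + quad (wt_R G t) (control G S u t \<omega>)) \<partial>prob_sp G)"

definition sensing_cost :: "('w, 'i) lqg \<Rightarrow> 'i set \<Rightarrow> real" where
  "sensing_cost G S = (\<Sum>i\<in>S. sens_cost G i)"

section \<open>The two co-design problems\<close>

definition optimal_budgeted :: "('w, 'i) lqg \<Rightarrow> real \<Rightarrow> 'i set \<Rightarrow> 'i policy \<Rightarrow> bool" where
  "optimal_budgeted G b S u \<longleftrightarrow>
     is_arg_min (\<lambda>(S, u). lqg_cost G S u)
       (\<lambda>(S, u). S \<subseteq> sensors G \<and> is_policy G S u \<and> sensing_cost G S \<le> b) (S, u)"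

definition optimal_min_sensing :: "('w, 'i) lqg \<Rightarrow> real \<Rightarrow> 'i set \<Rightarrow> 'i policy \<Rightarrow> bool" where
  "optimal_min_sensing G \<kappa> S u \<longleftrightarrow>
     is_arg_min (\<lambda>(S, u). sensing_cost G S)
       (\<lambda>(S, u). S \<subseteq> sensors G \<and> is_policy G S u \<and> lqg_cost G S u \<le> ennreal \<kappa>) (S, u)"

section \<open>The Kalman estimator and the Riccati recursion\<close>

text \<open>Componentwise conditional expectation given the \<open>\<sigma>\<close>-algebra of the history up to \<open>t\<close>.\<close>

definition kalman_est :: "('w, 'i) lqg \<Rightarrow> 'i set \<Rightarrow> 'i policy \<Rightarrow> nat \<Rightarrow> 'w \<Rightarrow> real vec" where
  "kalman_est G S u t \<omega> =
     vec (dimx G) (\<lambda>j.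
       real_cond_exp (prob_sp G)
         (vimage_algebra (space (prob_sp G)) (history G S u t) (obs_space G S t))
         (\<lambda>\<omega>. state G S u t \<omega> $ j) \<omega>)"

text \<open>
  All policies of finite cost give the same error covariance. This is a consequence of the
  dynamics, so the policy remains an argument here.
\<close>

definition err_cov :: "('w, 'i) lqg \<Rightarrow> 'i set \<Rightarrow> 'i policy \<Rightarrow> nat \<Rightarrow> real mat" where
  "err_cov G S u t =
     mat (dimx G) (dimx G) (\<lambda>(j, k).
       \<integral>\<omega>. (state G S u t \<omega> $ j - kalman_est G S u t \<omega> $ j)
          * (state G S u t \<omega> $ k - kalman_est G S u t \<omega> $ k) \<partial>prob_sp G)"

text \<open>
  For a solution to exist the matrices inverted in the recursion have to be invertible. This is
  automatic for all of them except \<open>St t\<close>, as \<open>wt_Q G t\<close> may be singular.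
\<close>

definition riccati_solution ::
    "('w, 'i) lqg \<Rightarrow> (nat \<Rightarrow> real mat) \<Rightarrow> (nat \<Rightarrow> real mat) \<Rightarrow> (nat \<Rightarrow> real mat)
       \<Rightarrow> (nat \<Rightarrow> real mat) \<Rightarrow> (nat \<Rightarrow> real mat) \<Rightarrow> bool" where
  "riccati_solution G St Nt Mt K \<Theta> \<longleftrightarrow>
     Nt (horizon G + 1) = 0\<^sub>m (dimx G) (dimx G) \<and>
     (\<forall>t \<in> {1..horizon G}.
        St t = wt_Q G t + Nt (t + 1) \<and>
        invertible_mat (St t) \<and>
        Nt t = (sys_A G t)\<^sup>T
                 * minv (minv (St t) + sys_B G t * minv (wt_R G t) * (sys_B G t)\<^sup>T)
                 * sys_A G t \<and>
        Mt t = (sys_B G t)\<^sup>T * St t * sys_B G t + wt_R G t \<and>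
        K t = - (minv (Mt t) * (sys_B G t)\<^sup>T * St t * sys_A G t) \<and>
        \<Theta> t = (K t)\<^sup>T * Mt t * K t)"

text \<open>
  \<open>u\<^sub>t = K\<^sub>t x\<^sup>^\<^sub>t\<close> along the closed loop that \<open>u\<close> itself generates. Conditional expectations are
  determined up to null sets, so the equality is almost sure.
\<close>

definition kalman_controller ::
    "('w, 'i) lqg \<Rightarrow> (nat \<Rightarrow> real mat) \<Rightarrow> 'i set \<Rightarrow> 'i policy \<Rightarrow> bool" where
  "kalman_controller G K S u \<longleftrightarrow>
     is_policy G S u \<and>
     (\<forall>t \<in> {1..horizon G}.
        AE \<omega> in prob_sp G. control G S u t \<omega> = K t *\<^sub>v kalman_est G S u t \<omega>)"

definition sensing_objective ::
    "('w, 'i) lqg \<Rightarrow> (nat \<Rightarrow> real mat) \<Rightarrow> ('i set \<Rightarrow> nat \<Rightarrow> real mat) \<Rightarrow> 'i set \<Rightarrow> real" where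
  "sensing_objective G \<Theta> \<Sigma> S = (\<Sum>t=1..horizon G. tr (\<Theta> t * \<Sigma> S t))"

definition cascade_budgeted ::
    "('w, 'i) lqg \<Rightarrow> (nat \<Rightarrow> real mat) \<Rightarrow> (nat \<Rightarrow> real mat) \<Rightarrow> ('i set \<Rightarrow> nat \<Rightarrow> real mat)
       \<Rightarrow> real \<Rightarrow> 'i set \<Rightarrow> 'i policy \<Rightarrow> bool" where
  "cascade_budgeted G K \<Theta> \<Sigma> b S u \<longleftrightarrow>
     is_arg_min (sensing_objective G \<Theta> \<Sigma>) (\<lambda>S. S \<subseteq> sensors G \<and> sensing_cost G S \<le> b) S \<and>
     kalman_controller G K S u"

definition cascade_min_sensing ::
    "('w, 'i) lqg \<Rightarrow> (nat \<Rightarrow> real mat) \<Rightarrow> (nat \<Rightarrow> real mat) \<Rightarrow> ('i set \<Rightarrow> nat \<Rightarrow> real mat)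
       \<Rightarrow> real \<Rightarrow> 'i set \<Rightarrow> 'i policy \<Rightarrow> bool" where
  "cascade_min_sensing G K \<Theta> \<Sigma> \<kappa>' S u \<longleftrightarrow>
     is_arg_min (sensing_cost G) (\<lambda>S. S \<subseteq> sensors G \<and> sensing_objective G \<Theta> \<Sigma> S \<le> \<kappa>') S \<and>
     kalman_controller G K S u"

end

theory Submission
  imports Defs "Jordan_Normal_Form.Determinant"
begin

text \<open>
  Completing the square with the Riccati matrices turns each stage cost into a telescoping term, a
  noise term and \<open>(u\<^sub>t - K\<^sub>t x\<^sub>t)\<^sup>T M\<^sub>t (u\<^sub>t - K\<^sub>t x\<^sub>t)\<close>; the noise \<open>w\<^sub>t\<close> is centred and independent of
  \<open>x\<^sub>t\<close> and \<open>u\<^sub>t\<close>, so the cross term has mean zero. Since the estimation error is orthogonal to every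
  square-integrable function of the history, the last term has mean \<open>tr (\<Theta>\<^sub>t \<Sigma>\<^sub>t)\<close> plus the mean of the
  same form in \<open>u\<^sub>t - K\<^sub>t E[x\<^sub>t | y]\<close>, which is nonnegative and vanishes exactly for the Kalman controller.
  Two policies on the same sensors generate the same observation \<open>\<sigma>\<close>-algebras and states that differ by
  an observable quantity; hence the error covariance does not depend on the policy, and for fixed
  sensors the least cost is a constant plus the sensing objective.
  Gaussianity enters only through first and second moments.
\<close>

section \<open>Quadratic forms and the Riccati step\<close>

text \<open>Finite cost supplies them: the control weights are definite, and the weighted mean
  squares of the controls are part of the cost. For the same reason the error covariances are read
  off reference policies of finite cost. The Kalman controller is given by a condition on the loop
  that it itself generates, while an estimate is a function on the probability space and not on
  histories. Its existence is therefore proved by recursion over time, with a factorization through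
  the history at each step. In the second problem the cost bound may leave slack, so an optimal pair
  may use another controller on the same sensors. This is why the converse either replaces the
  controller or asks that it minimize the cost for its own sensors. The constant
  \<open>\<kappa>'\<close> contains \<open>tr (init_cov G * Nt 1)\<close>, which is the mean of the
  form \<open>Nt 1\<close> at the initial state when that state is centred.\<close>

lemma scalar_prod_mult_mat_vec:
  fixes A :: "real mat"
  assumes "A \<in> carrier_mat n m" "x \<in> carrier_vec n" "y \<in> carrier_vec m"
  shows "x \<bullet> (A *\<^sub>v y) = (A\<^sup>T *\<^sub>v x) \<bullet> y"
  using assms transpose_vec_mult_scalar[of A n m y x]
  by (metis comm_scalar_prod mult_mat_vec_carrier transpose_carrier_mat)

lemma scalar_prod_symmetric_mat:
  fixes A :: "real mat"
  assumes "A \<in> carrier_mat n n" "A\<^sup>T = A" "x \<in> carrier_vec n" "y \<in> carrier_vec n"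
  shows "x \<bullet> (A *\<^sub>v y) = y \<bullet> (A *\<^sub>v x)"
  using assms scalar_prod_mult_mat_vec[of A n n x y] comm_scalar_prod[of "A *\<^sub>v x" n y] by simp

lemma quad_add:
  assumes "A \<in> carrier_mat n n" "A\<^sup>T = A" "x \<in> carrier_vec n" "y \<in> carrier_vec n"
  shows "quad A (x + y) = quad A x + 2 * (x \<bullet> (A *\<^sub>v y)) + quad A y"
  using assms scalar_prod_symmetric_mat[OF assms]
  by (simp add: quad_def mult_add_distrib_mat_vec[of _ n n] add_scalar_prod_distrib[of _ n]
      scalar_prod_add_distrib[of _ n])

lemma quad_smult:
  assumes "A \<in> carrier_mat n n" "x \<in> carrier_vec n"
  shows "quad A (c \<cdot>\<^sub>v x) = c\<^sup>2 * quad A x"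
  using assms by (simp add: quad_def mult_mat_vec[of _ n n] power2_eq_square)

lemma quad_add_mat:
  assumes "A \<in> carrier_mat n n" "B \<in> carrier_mat n n" "x \<in> carrier_vec n"
  shows "quad (A + B) x = quad A x + quad B x"
  using assms by (simp add: quad_def add_mult_distrib_mat_vec[of _ n n] scalar_prod_add_distrib[of _ n])

lemma quad_mult_transpose:
  assumes "S \<in> carrier_mat n n" "A \<in> carrier_mat n m" "x \<in> carrier_vec m"
  shows "quad (A\<^sup>T * S * A) x = quad S (A *\<^sub>v x)"
proof -
  have "(A\<^sup>T * S * A) *\<^sub>v x = A\<^sup>T *\<^sub>v (S *\<^sub>v (A *\<^sub>v x))"
    using assms by (simp add: assoc_mult_mat_vec[of _ m n] assoc_mult_mat_vec[of _ m n _ m])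
  then show ?thesis
    using assms scalar_prod_mult_mat_vec[of "A\<^sup>T" m n x "S *\<^sub>v (A *\<^sub>v x)"]
    by (simp add: quad_def)
qed

text \<open>The form is nonnegative along the line \<open>x + t y\<close>, so a polynomial of degree
  at most two in \<open>t\<close> has no negative value. A semidefinite form can vanish at
  \<open>y\<close>; the polynomial is then affine, and this case is separate.\<close>

lemma cauchy_schwarz_pos_semidef:
  assumes "pos_semidef n A" "x \<in> carrier_vec n" "y \<in> carrier_vec n"
  shows "(x \<bullet> (A *\<^sub>v y))\<^sup>2 \<le> quad A x * quad A y"
proof -
  have A: "A \<in> carrier_mat n n" "A\<^sup>T = A" and nn: "\<And>z. z \<in> carrier_vec n \<Longrightarrow> 0 \<le> quad A z"
    using assms(1) by (auto simp: pos_semidef_def)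
  let ?c = "x \<bullet> (A *\<^sub>v y)"
  have *: "0 \<le> quad A x + 2 * t * ?c + t\<^sup>2 * quad A y" for t
    using nn[of "x + t \<cdot>\<^sub>v y"] assms(2,3) A
    by (simp add: quad_add[OF A] quad_smult mult_mat_vec[of _ n n] algebra_simps)
  show ?thesis
  proof (cases "quad A y = 0")
    case True
    have "?c = 0"
    proof (rule ccontr)
      assume "?c \<noteq> 0"
      \<comment> \<open>At this \<open>t\<close> the affine function takes the value
        \<open>-1\<close>.\<close>
      then show False using *[of "- (quad A x + 1) / (2 * ?c)"] True by (simp add: field_simps)
    qed
    with True show ?thesis by simp
  next
    case False
    then have "0 < quad A y" using nn[OF assms(3)] by simp
    \<comment> \<open>This \<open>t\<close> minimizes the polynomial.\<close>
    then show ?thesis using *[of "- ?c / quad A y"]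
      by (simp add: field_simps power2_eq_square)
  qed
qed

section \<open>Definite matrices and their inverses\<close>

lemma pos_def_imp_pos_semidef: "pos_def n A \<Longrightarrow> pos_semidef n A"
  unfolding pos_def_def pos_semidef_def by (force simp: quad_def)

text \<open>\<open>mat_inverse\<close> is specified through the units of the matrix ring of a fixed
  dimension, so the inverse obtained from \<open>invertible_mat\<close> must first be shown to be
  square of that dimension.\<close>

lemma minv_inverse:
  fixes A :: "real mat"
  assumes "A \<in> carrier_mat n n" "invertible_mat A"
  shows "minv A \<in> carrier_mat n n" "A * minv A = 1\<^sub>m n" "minv A * A = 1\<^sub>m n"
proof -
  obtain B where B: "A * B = 1\<^sub>m n" "B * A = 1\<^sub>m (dim_row B)"
    using assms unfolding invertible_mat_def inverts_mat_def by auto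
  have "dim_row B = n" using B assms(1) by (metis carrier_matD(2) index_mult_mat(3) index_one_mat(3))
  moreover have "dim_col B = n" using B(1) by (metis index_mult_mat(3) index_one_mat(3))
  ultimately have "A \<in> Units (ring_mat TYPE(real) n ())"
    using B assms(1) unfolding Units_def by (auto simp: ring_mat_simps intro!: bexI[of _ B])
  then obtain C where "mat_inverse A = Some C"
    using mat_inverse(1)[OF assms(1), of "()"] by (cases "mat_inverse A") auto
  then show "minv A \<in> carrier_mat n n" "A * minv A = 1\<^sub>m n" "minv A * A = 1\<^sub>m n"
    using mat_inverse(2)[OF assms(1)] by (auto simp: minv_def)
qed

lemma pos_def_invertible:
  assumes "pos_def n A"
  shows "invertible_mat A"
proof -
  have A: "A \<in> carrier_mat n n" using assms by (simp add: pos_def_def)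
  have "det A \<noteq> 0"
    using assms by (force simp: pos_def_def quad_def det_0_iff_vec_prod_zero_field[OF A])
  then have "A \<in> Units (ring_mat TYPE(real) n ())" using det_non_zero_imp_unit[OF A] by simp
  then obtain B where "B \<in> carrier_mat n n" "A * B = 1\<^sub>m n" "B * A = 1\<^sub>m n"
    unfolding Units_def by (auto simp: ring_mat_simps)
  then show ?thesis using A unfolding invertible_mat_def inverts_mat_def by (auto intro!: exI[of _ B])
qed

lemmas pos_def_minv = minv_inverse[OF _ pos_def_invertible]

text \<open>With \<open>y = minv A *\<^sub>v z\<close>, Cauchy--Schwarz bounds the square of
  \<open>z \<bullet> z\<close> by \<open>quad A z * quad A y\<close>, so a nonzero \<open>z\<close>
  cannot be a zero of the form. This makes the Riccati matrices \<open>St t\<close> definite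
  although \<open>wt_Q G t\<close> may be singular.\<close>

lemma pos_semidef_invertible_imp_pos_def:
  assumes "pos_semidef n A" "invertible_mat A"
  shows "pos_def n A"
proof -
  have A: "A \<in> carrier_mat n n" "A\<^sup>T = A" using assms(1) by (auto simp: pos_semidef_def)
  note inv = minv_inverse[OF A(1) assms(2)]
  have "0 < quad A z" if z: "z \<in> carrier_vec n" "z \<noteq> 0\<^sub>v n" for z
  proof (rule ccontr)
    assume "\<not> 0 < quad A z"
    then have q: "quad A z = 0" using assms(1) z by (force simp: pos_semidef_def)
    let ?y = "minv A *\<^sub>v z"
    have "A *\<^sub>v ?y = z" using inv A z by (simp add: assoc_mult_mat_vec[symmetric, of _ n n _ n])
    then have "z \<bullet> z = 0"
      using cauchy_schwarz_pos_semidef[OF assms(1) z(1), of ?y] inv z q by simp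
    then show False using z conjugate_square_eq_0_vec[of z n] by simp
  qed
  then show ?thesis using A by (auto simp: pos_def_def)
qed

lemma minv_symmetric:
  fixes A :: "real mat"
  assumes "A \<in> carrier_mat n n" "A\<^sup>T = A" "invertible_mat A"
  shows "(minv A)\<^sup>T = minv A"
proof -
  note inv = minv_inverse[OF assms(1,3)]
  have "A * (minv A)\<^sup>T = 1\<^sub>m n"
    using transpose_mult[OF inv(1) assms(1)] inv assms(2) by simp
  then have "minv A * (A * (minv A)\<^sup>T) = minv A" using inv by simp
  moreover have "minv A * (A * (minv A)\<^sup>T) = (minv A)\<^sup>T"
    using inv assms(1) by (simp add: assoc_mult_mat[symmetric, of _ n n _ n _ n])
  ultimately show ?thesis by simp
qed

lemma minv_mult_vec:
  fixes A :: "real mat"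
  assumes "A \<in> carrier_mat n n" "invertible_mat A" "x \<in> carrier_vec n"
  shows "A *\<^sub>v (minv A *\<^sub>v x) = x" "minv A *\<^sub>v (A *\<^sub>v x) = x"
  using minv_inverse[OF assms(1,2)] assms by (simp_all add: assoc_mult_mat_vec[symmetric, of _ n n _ n])

lemma pos_def_minv_pos_def:
  assumes "pos_def n A"
  shows "pos_def n (minv A)"
proof -
  have A: "A \<in> carrier_mat n n" "A\<^sup>T = A" using assms by (auto simp: pos_def_def)
  note inv = pos_def_minv[OF A(1) assms]
  have "0 < quad (minv A) z" if z: "z \<in> carrier_vec n" "z \<noteq> 0\<^sub>v n" for z
  proof -
    let ?y = "minv A *\<^sub>v z"
    have y: "?y \<in> carrier_vec n" "A *\<^sub>v ?y = z"
      using inv z minv_mult_vec(1)[OF A(1) pos_def_invertible[OF assms] z(1)] by auto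
    have "?y \<noteq> 0\<^sub>v n" using y z A by (metis eq_vecI zero_carrier_vec mult_mat_vec_carrier carrier_vecD index_mult_mat_vec index_zero_vec row_carrier_vec scalar_prod_right_zero carrier_matD)
    then have "0 < quad A ?y" using assms y by (auto simp: pos_def_def)
    also have "quad A ?y = quad (minv A) z" using y z comm_scalar_prod[of ?y n z] by (simp add: quad_def)
    finally show ?thesis .
  qed
  then show ?thesis using inv minv_symmetric[OF A pos_def_invertible[OF assms]] by (auto simp: pos_def_def)
qed

lemma pos_semidef_add:
  "pos_semidef n A \<Longrightarrow> pos_semidef n B \<Longrightarrow> pos_semidef n (A + B)"
  by (auto simp: pos_semidef_def transpose_add[of _ n n] quad_add_mat[of _ n])

lemma pos_def_add_pos_semidef:
  "pos_def n A \<Longrightarrow> pos_semidef n B \<Longrightarrow> pos_def n (A + B)"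
  unfolding pos_def_def pos_semidef_def by (auto simp: transpose_add[of _ n n] quad_add_mat[of _ n] intro: add_pos_nonneg)

lemma pos_semidef_mult_transpose:
  assumes "pos_semidef n S" "A \<in> carrier_mat n m"
  shows "pos_semidef m (A\<^sup>T * S * A)"
proof -
  have S: "S \<in> carrier_mat n n" "S\<^sup>T = S" using assms(1) by (auto simp: pos_semidef_def)
  have "(A\<^sup>T * S * A)\<^sup>T = A\<^sup>T * (S * A)"
    using S assms(2) by (simp add: transpose_mult[of "A\<^sup>T" m n "S * A" m] transpose_mult[of S n n A m])
  also have "\<dots> = A\<^sup>T * S * A" using S assms(2) by (simp add: assoc_mult_mat[of _ m n _ n _ m])
  finally show ?thesis
    using assms S quad_mult_transpose[OF S(1) assms(2)] by (auto simp: pos_semidef_def)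
qed

lemma quad_diff:
  assumes "A \<in> carrier_mat n n" "A\<^sup>T = A" "x \<in> carrier_vec n" "y \<in> carrier_vec n"
  shows "quad A (x - y) = quad A x - 2 * (x \<bullet> (A *\<^sub>v y)) + quad A y"
proof -
  have "x - y = x + (-1) \<cdot>\<^sub>v y" using assms by (intro eq_vecI) auto
  then show ?thesis
    using assms quad_add[OF assms(1-3), of "(-1) \<cdot>\<^sub>v y"] quad_smult[OF assms(1,4), of "-1"]
    by (simp add: mult_mat_vec[of _ n n])
qed

lemma pos_semidef_nonneg: "pos_semidef n A \<Longrightarrow> x \<in> carrier_vec n \<Longrightarrow> 0 \<le> quad A x"
  by (simp add: pos_semidef_def)

lemma pos_semidef_carrier: "pos_semidef n A \<Longrightarrow> A \<in> carrier_mat n n" "pos_semidef n A \<Longrightarrow> A\<^sup>T = A"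
  by (auto simp: pos_semidef_def)

lemma pos_def_carrier: "pos_def n A \<Longrightarrow> A \<in> carrier_mat n n" "pos_def n A \<Longrightarrow> A\<^sup>T = A"
  by (auto simp: pos_def_def)

text \<open>Cauchy--Schwarz for the form \<open>A\<close>, applied to \<open>minv A *\<^sub>v unit_vec n j\<close>.\<close>

lemma pos_def_coordinate_bound:
  assumes "pos_def n A" "j < n"
  shows "\<exists>c\<ge>0. \<forall>z \<in> carrier_vec n. (z $ j)\<^sup>2 \<le> c * quad A z"
proof -
  note A = pos_def_carrier[OF assms(1)]
  let ?p = "minv A *\<^sub>v unit_vec n j"
  have p: "?p \<in> carrier_vec n" using pos_def_minv[OF A(1) assms(1)] by auto
  have Ap: "A *\<^sub>v ?p = unit_vec n j"
    by (rule minv_mult_vec[OF A(1) pos_def_invertible[OF assms(1)]]) simp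
  have "(z $ j)\<^sup>2 \<le> quad A ?p * quad A z" if z: "z \<in> carrier_vec n" for z
  proof -
    have "?p \<bullet> (A *\<^sub>v z) = z \<bullet> (A *\<^sub>v ?p)"
      using scalar_prod_symmetric_mat[OF A p z] .
    then have "?p \<bullet> (A *\<^sub>v z) = z $ j" using Ap z assms(2) by simp
    then show ?thesis using cauchy_schwarz_pos_semidef[OF pos_def_imp_pos_semidef[OF assms(1)] p z] by simp
  qed
  then show ?thesis using pos_semidef_nonneg[OF pos_def_imp_pos_semidef[OF assms(1)] p] by blast
qed

lemma quad_zero: "z \<in> carrier_vec n \<Longrightarrow> quad (0\<^sub>m n n) z = 0"
proof -
  assume z: "z \<in> carrier_vec n"
  then have "0\<^sub>m n n *\<^sub>v z = 0\<^sub>v n" by (intro eq_vecI) auto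
  with z show ?thesis by (simp add: quad_def)
qed

lemma pos_semidef_zero: "pos_semidef n (0\<^sub>m n n)"
  by (simp add: pos_semidef_def quad_zero)

text \<open>The Bellman equation of one stage: the least cost from \<open>x\<close>, plus the
  squared distance, measured by \<open>M\<close>, of \<open>u\<close> from the minimizer
  \<open>K *\<^sub>v x\<close>. The inverse formulas enter as linear equations solved by
  \<open>p\<close> and \<open>w\<close>, which tie the gain formula in \<open>M\<close> to the value
  formula in \<open>P\<close>.\<close>

lemma riccati_step:
  fixes S R A B :: "real mat"
  assumes S: "pos_def n S" and R: "pos_def m R"
    and A: "A \<in> carrier_mat n n" and B: "B \<in> carrier_mat n m"
    and P_def: "P = minv (minv S + B * minv R * B\<^sup>T)"
    and M_def: "M = B\<^sup>T * S * B + R"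
    and K_def: "K = - (minv M * B\<^sup>T * S * A)"
  shows "pos_semidef n (A\<^sup>T * P * A)" and "pos_def m M" and "K \<in> carrier_mat m n"
    and "\<And>x u. x \<in> carrier_vec n \<Longrightarrow> u \<in> carrier_vec m \<Longrightarrow>
           quad S (A *\<^sub>v x + B *\<^sub>v u) + quad R u = quad (A\<^sup>T * P * A) x + quad M (u - K *\<^sub>v x)"
proof -
  have S': "S \<in> carrier_mat n n" "S\<^sup>T = S" and R': "R \<in> carrier_mat m m" "R\<^sup>T = R"
    using S R by (auto simp: pos_def_def)
  note Si = pos_def_minv[OF S'(1) S] and Ri = pos_def_minv[OF R'(1) R]
  let ?L = "minv S + B * minv R * B\<^sup>T"
  have "pos_semidef n ((B\<^sup>T)\<^sup>T * minv R * B\<^sup>T)"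
    by (rule pos_semidef_mult_transpose) (use B pos_def_imp_pos_semidef[OF pos_def_minv_pos_def[OF R]] in auto)
  then have L: "pos_def n ?L"
    using pos_def_add_pos_semidef[OF pos_def_minv_pos_def[OF S]] by simp
  then have L': "?L \<in> carrier_mat n n" by (simp add: pos_def_def)
  have P: "pos_def n P" unfolding P_def by (rule pos_def_minv_pos_def[OF L])
  have P': "P \<in> carrier_mat n n" using P by (simp add: pos_def_def)
  show "pos_semidef n (A\<^sup>T * P * A)"
    by (rule pos_semidef_mult_transpose[OF pos_def_imp_pos_semidef[OF P] A])
  have BSB: "pos_semidef m (B\<^sup>T * S * B)"
    by (rule pos_semidef_mult_transpose[OF pos_def_imp_pos_semidef[OF S] B])
  have M_eq: "M = R + B\<^sup>T * S * B"
    unfolding M_def using B S' R' by (intro comm_add_mat[of _ m m]) auto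
  show M: "pos_def m M"
    unfolding M_eq by (rule pos_def_add_pos_semidef[OF R BSB])
  have M': "M \<in> carrier_mat m m" using M by (simp add: pos_def_def)
  note Mi = pos_def_minv[OF M' M]
  show K: "K \<in> carrier_mat m n" unfolding K_def using Mi A B S' by auto
  fix x u :: "real vec" assume x: "x \<in> carrier_vec n" and u: "u \<in> carrier_vec m"
  \<comment> \<open>The costate \<open>p\<close> and the optimal control \<open>w\<close> satisfy \<open>S (A x + B w) = p\<close> and \<open>R w = - B\<^sup>T p\<close>.\<close>
  define v where "v = A *\<^sub>v x"
  define p where "p = P *\<^sub>v v"
  define w where "w = - (minv R *\<^sub>v (B\<^sup>T *\<^sub>v p))"
  define z where "z = v + B *\<^sub>v w"
  have v: "v \<in> carrier_vec n" and p: "p \<in> carrier_vec n" and w: "w \<in> carrier_vec m"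
    and Bp: "B\<^sup>T *\<^sub>v p \<in> carrier_vec m" and z: "z \<in> carrier_vec n"
    using x A P' B Ri v_def p_def w_def z_def by auto
  \<comment> \<open>\<open>P\<close> is the inverse of \<open>?L\<close>. Applying \<open>?L\<close>
    to \<open>p\<close> splits \<open>v\<close> into \<open>minv S *\<^sub>v p\<close> and
    \<open>- (B *\<^sub>v w)\<close>, so the controlled next state \<open>z\<close> is
    \<open>minv S *\<^sub>v p\<close>.\<close>
  have "v = ?L *\<^sub>v p"
    unfolding p_def P_def using minv_mult_vec(1)[OF L' pos_def_invertible[OF L] v] by simp
  also have "\<dots> = minv S *\<^sub>v p + B *\<^sub>v (minv R *\<^sub>v (B\<^sup>T *\<^sub>v p))"
    using B Ri Si p by (simp add: add_mult_distrib_mat_vec[of _ n n] assoc_mult_mat_vec[of _ n m _ n]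
        assoc_mult_mat_vec[of _ n m _ m])
  also have "B *\<^sub>v (minv R *\<^sub>v (B\<^sup>T *\<^sub>v p)) = - (B *\<^sub>v w)"
    unfolding w_def using B Ri Bp by (intro eq_vecI) auto
  finally have "z = minv S *\<^sub>v p"
    unfolding z_def using B w Si p by (intro eq_vecI) auto
  then have Sz: "S *\<^sub>v z = p"
    using minv_mult_vec(1)[OF S'(1) pos_def_invertible[OF S] p] by simp
  have Rw: "R *\<^sub>v w = - (B\<^sup>T *\<^sub>v p)"
  proof -
    have "R *\<^sub>v w = - (R *\<^sub>v (minv R *\<^sub>v (B\<^sup>T *\<^sub>v p)))"
      unfolding w_def using R' Ri Bp by (intro eq_vecI) auto
    then show ?thesis using minv_mult_vec(1)[OF R'(1) pos_def_invertible[OF R] Bp] by simp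
  qed
  \<comment> \<open>This leads to the stationarity condition of the stage cost in \<open>u\<close>;
    solving it with \<open>minv M\<close> gives the gain formula, hence
    \<open>w = K *\<^sub>v x\<close>.\<close>
  have "M *\<^sub>v w = B\<^sup>T *\<^sub>v (S *\<^sub>v (B *\<^sub>v w)) + R *\<^sub>v w"
    unfolding M_def using B S' R' w
    by (simp add: add_mult_distrib_mat_vec[of _ m m] assoc_mult_mat_vec[of _ m n _ m]
        assoc_mult_mat_vec[of _ m n _ n])
  also have "\<dots> = B\<^sup>T *\<^sub>v (S *\<^sub>v (B *\<^sub>v w)) + - (B\<^sup>T *\<^sub>v (S *\<^sub>v v + S *\<^sub>v (B *\<^sub>v w)))"
    using B S' v w by (simp add: Rw Sz[symmetric] z_def mult_add_distrib_mat_vec[of _ n n])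
  also have "\<dots> = - (B\<^sup>T *\<^sub>v (S *\<^sub>v v))"
    using B S' v w by (subst mult_add_distrib_mat_vec[of _ m n]) (auto intro!: eq_vecI)
  finally have Mw: "M *\<^sub>v w = - (B\<^sup>T *\<^sub>v (S *\<^sub>v v))" .
  have "w = minv M *\<^sub>v (M *\<^sub>v w)"
    using minv_mult_vec(2)[OF M' pos_def_invertible[OF M] w] by simp
  also have "\<dots> = - (minv M *\<^sub>v (B\<^sup>T *\<^sub>v (S *\<^sub>v v)))"
    unfolding Mw using B S' v Mi by (intro eq_vecI) auto
  also have "minv M *\<^sub>v (B\<^sup>T *\<^sub>v (S *\<^sub>v v)) = (minv M * B\<^sup>T * S * A) *\<^sub>v x"
    unfolding v_def using A B S' Mi x
    by (simp add: assoc_mult_mat_vec[of _ m n _ n] assoc_mult_mat_vec[of _ m m _ n])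
  also have "- \<dots> = K *\<^sub>v x"
    unfolding K_def using A B S' Mi x by (intro eq_vecI) auto
  finally have wK: "w = K *\<^sub>v x" .
  define e where "e = u - w"
  have e: "e \<in> carrier_vec m" and ue: "u = w + e"
    unfolding e_def using u w by auto
  have "A *\<^sub>v x + B *\<^sub>v u = z + B *\<^sub>v e"
    unfolding z_def ue v_def[symmetric] using B v w e
    by (simp add: mult_add_distrib_mat_vec[of _ n m] assoc_add_vec[of _ n])
  \<comment> \<open>Expansion around the minimizer: both cross terms become
    \<open>e \<bullet> (B\<^sup>T *\<^sub>v p)\<close>, with opposite signs, and the part of
    \<open>quad S z\<close> that contains \<open>w\<close> cancels \<open>quad R w\<close>.\<close>
  then have "quad S (A *\<^sub>v x + B *\<^sub>v u) + quad R u = quad S (z + B *\<^sub>v e) + quad R (w + e)"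
    by (simp add: ue)
  also have "\<dots> = quad S z + 2 * (z \<bullet> (S *\<^sub>v (B *\<^sub>v e))) + quad S (B *\<^sub>v e)
      + (quad R w + 2 * (w \<bullet> (R *\<^sub>v e)) + quad R e)"
    using B z w e by (simp add: quad_add[OF S'] quad_add[OF R'])
  also have "z \<bullet> (S *\<^sub>v (B *\<^sub>v e)) = (B *\<^sub>v e) \<bullet> p"
    using scalar_prod_symmetric_mat[OF S' z, of "B *\<^sub>v e"] B e Sz by simp
  also have "\<dots> = e \<bullet> (B\<^sup>T *\<^sub>v p)"
    using scalar_prod_mult_mat_vec[of "B\<^sup>T" m n e p] B e p by simp
  also have "w \<bullet> (R *\<^sub>v e) = - (e \<bullet> (B\<^sup>T *\<^sub>v p))"
    using scalar_prod_symmetric_mat[OF R' w e] B e by (simp add: Rw)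
  also have "quad S z = v \<bullet> p + w \<bullet> (B\<^sup>T *\<^sub>v p)"
  proof -
    have "quad S z = (v + B *\<^sub>v w) \<bullet> p" by (simp add: quad_def Sz) (simp add: z_def)
    also have "\<dots> = v \<bullet> p + (B *\<^sub>v w) \<bullet> p" using v B w p by (simp add: add_scalar_prod_distrib[of _ n])
    also have "(B *\<^sub>v w) \<bullet> p = w \<bullet> (B\<^sup>T *\<^sub>v p)"
      using scalar_prod_mult_mat_vec[of "B\<^sup>T" m n w p] B w p by simp
    finally show ?thesis .
  qed
  also have "quad R w = - (w \<bullet> (B\<^sup>T *\<^sub>v p))" using w B by (simp add: quad_def Rw)
  also have "quad S (B *\<^sub>v e) = quad (B\<^sup>T * S * B) e"
    using quad_mult_transpose[OF S'(1) B e] by simp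
  also have "v \<bullet> p = quad (A\<^sup>T * P * A) x"
    using quad_mult_transpose[OF P' A x] by (simp add: quad_def p_def v_def)
  finally have "quad S (A *\<^sub>v x + B *\<^sub>v u) + quad R u
      = quad (A\<^sup>T * P * A) x + (quad (B\<^sup>T * S * B) e + quad R e)"
    by simp
  also have "quad (B\<^sup>T * S * B) e + quad R e = quad M e"
    unfolding M_def using B S' R' e by (subst quad_add_mat[of _ m]) auto
  finally show "quad S (A *\<^sub>v x + B *\<^sub>v u) + quad R u = quad (A\<^sup>T * P * A) x + quad M (u - K *\<^sub>v x)"
    by (simp add: e_def wK)
qed

section \<open>Square-integrable random vectors\<close>

lemma index_mult_mat_vec_sum:
  fixes A :: "real mat"
  assumes "A \<in> carrier_mat n m" "x \<in> carrier_vec m" "i < n"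
  shows "(A *\<^sub>v x) $ i = (\<Sum>j<m. A $$ (i, j) * x $ j)"
  using assms by (auto simp: scalar_prod_def atLeast0LessThan intro!: sum.cong)

lemma scalar_prod_sum:
  "y \<in> carrier_vec n \<Longrightarrow> x \<bullet> y = (\<Sum>j<n. x $ j * y $ j)"
  by (auto simp: scalar_prod_def atLeast0LessThan intro!: sum.cong)

lemma scalar_prod_mult_mat_vec_sum:
  fixes A :: "real mat"
  assumes "A \<in> carrier_mat n m" "x \<in> carrier_vec n" "y \<in> carrier_vec m"
  shows "x \<bullet> (A *\<^sub>v y) = (\<Sum>i<n. \<Sum>j<m. A $$ (i, j) * (x $ i * y $ j))"
proof -
  have "x \<bullet> (A *\<^sub>v y) = (\<Sum>i<n. x $ i * (A *\<^sub>v y) $ i)"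
    using assms by (intro scalar_prod_sum) auto
  also have "\<dots> = (\<Sum>i<n. \<Sum>j<m. A $$ (i, j) * (x $ i * y $ j))"
    using assms by (intro sum.cong) (auto simp: index_mult_mat_vec_sum[of _ n m] sum_distrib_left mult_ac
        simp del: index_mult_mat_vec)
  finally show ?thesis .
qed

section \<open>Measurability of vector-valued maps\<close>

lemma space_borel_vec [simp]: "space (borel_vec n) = carrier_vec n"
  by (simp add: borel_vec_def)

text \<open>The \<sigma>-algebra is pulled back along the coordinates, so measurability is
  coordinatewise. The carrier condition is a separate clause because the type does not fix the
  length of a vector.\<close>

lemma measurable_borel_vec_iff:
  "X \<in> measurable M (borel_vec n) \<longleftrightarrow>
     X \<in> space M \<rightarrow> carrier_vec n \<and> (\<forall>j<n. (\<lambda>\<omega>. X \<omega> $ j) \<in> borel_measurable M)"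
proof (intro iffI conjI allI impI)
  assume X: "X \<in> measurable M (borel_vec n)"
  then show "X \<in> space M \<rightarrow> carrier_vec n" using measurable_space[OF X] by auto
  fix j assume j: "j < n"
  have "(\<lambda>z. \<lambda>j\<in>{..<n}. z $ j) \<in> measurable (borel_vec n) (PiM {..<n} (\<lambda>_. borel :: real measure))"
    unfolding borel_vec_def by (rule measurable_vimage_algebra1) (auto simp: space_PiM)
  from measurable_compose[OF measurable_compose[OF X this] measurable_component_singleton[of j]]
  have "(\<lambda>\<omega>. (\<lambda>j\<in>{..<n}. X \<omega> $ j) j) \<in> borel_measurable M"
    using j by simp
  then show "(\<lambda>\<omega>. X \<omega> $ j) \<in> borel_measurable M" using j by simp
next
  assume *: "X \<in> space M \<rightarrow> carrier_vec n \<and> (\<forall>j<n. (\<lambda>\<omega>. X \<omega> $ j) \<in> borel_measurable M)"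
  then show "X \<in> measurable M (borel_vec n)"
    unfolding borel_vec_def by (intro measurable_vimage_algebra2 measurable_restrict) auto
qed

lemma measurable_borel_vecD:
  assumes "X \<in> measurable M (borel_vec n)"
  shows "\<omega> \<in> space M \<Longrightarrow> X \<omega> \<in> carrier_vec n"
    and "j < n \<Longrightarrow> (\<lambda>\<omega>. X \<omega> $ j) \<in> borel_measurable M"
  using assms by (auto simp: measurable_borel_vec_iff)

lemma measurable_borel_vec_add:
  assumes "X \<in> measurable M (borel_vec n)" "Y \<in> measurable M (borel_vec n)"
  shows "(\<lambda>\<omega>. X \<omega> + Y \<omega>) \<in> measurable M (borel_vec n)"
  unfolding measurable_borel_vec_iff
proof (intro conjI allI impI)
  fix j assume j: "j < n"
  have "(\<lambda>\<omega>. X \<omega> $ j + Y \<omega> $ j) \<in> borel_measurable M"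
    using assms j by (intro borel_measurable_add measurable_borel_vecD(2)) auto
  then show "(\<lambda>\<omega>. (X \<omega> + Y \<omega>) $ j) \<in> borel_measurable M"
    by (rule measurable_cong[THEN iffD1, rotated]) (use carrier_vecD[OF measurable_borel_vecD(1)[OF assms(2)]] j in auto)
qed (use measurable_borel_vecD(1)[OF assms(1)] measurable_borel_vecD(1)[OF assms(2)] in auto)

lemma measurable_borel_vec_diff:
  assumes "X \<in> measurable M (borel_vec n)" "Y \<in> measurable M (borel_vec n)"
  shows "(\<lambda>\<omega>. X \<omega> - Y \<omega>) \<in> measurable M (borel_vec n)"
  unfolding measurable_borel_vec_iff
proof (intro conjI allI impI)
  fix j assume j: "j < n"
  have "(\<lambda>\<omega>. X \<omega> $ j - Y \<omega> $ j) \<in> borel_measurable M"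
    using assms j by (intro borel_measurable_diff measurable_borel_vecD(2)) auto
  then show "(\<lambda>\<omega>. (X \<omega> - Y \<omega>) $ j) \<in> borel_measurable M"
    by (rule measurable_cong[THEN iffD1, rotated]) (use carrier_vecD[OF measurable_borel_vecD(1)[OF assms(2)]] j in auto)
qed (use measurable_borel_vecD(1)[OF assms(1)] measurable_borel_vecD(1)[OF assms(2)] in auto)

lemma measurable_borel_vec_mult:
  assumes "A \<in> carrier_mat n m" "X \<in> measurable M (borel_vec m)"
  shows "(\<lambda>\<omega>. A *\<^sub>v X \<omega>) \<in> measurable M (borel_vec n)"
  unfolding measurable_borel_vec_iff
proof (intro conjI allI impI)
  fix j assume j: "j < n"
  have "(\<lambda>\<omega>. \<Sum>k<m. A $$ (j, k) * X \<omega> $ k) \<in> borel_measurable M"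
    using assms j by (intro borel_measurable_sum borel_measurable_times measurable_borel_vecD(2)) auto
  then show "(\<lambda>\<omega>. (A *\<^sub>v X \<omega>) $ j) \<in> borel_measurable M"
    by (rule measurable_cong[THEN iffD1, rotated])
      (use measurable_borel_vecD(1)[OF assms(2)] j assms(1) in \<open>auto simp: index_mult_mat_vec_sum[of _ n m] simp del: index_mult_mat_vec\<close>)
qed (use assms measurable_borel_vecD(1)[OF assms(2)] in auto)

lemma borel_measurable_scalar_prod_mult:
  assumes "A \<in> carrier_mat n m" "X \<in> measurable M (borel_vec n)" "Y \<in> measurable M (borel_vec m)"
  shows "(\<lambda>\<omega>. X \<omega> \<bullet> (A *\<^sub>v Y \<omega>)) \<in> borel_measurable M"
proof -
  have "(\<lambda>\<omega>. \<Sum>i<n. \<Sum>j<m. A $$ (i, j) * (X \<omega> $ i * Y \<omega> $ j)) \<in> borel_measurable M"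
    using assms by (intro borel_measurable_sum borel_measurable_times) (auto simp: measurable_borel_vec_iff)
  then show ?thesis
    by (rule measurable_cong[THEN iffD1, rotated])
      (use measurable_borel_vecD(1)[OF assms(2)] measurable_borel_vecD(1)[OF assms(3)] assms(1)
        in \<open>auto simp: scalar_prod_mult_mat_vec_sum[of _ n m]\<close>)
qed

lemma borel_measurable_quad:
  "A \<in> carrier_mat n n \<Longrightarrow> X \<in> measurable M (borel_vec n) \<Longrightarrow> (\<lambda>\<omega>. quad A (X \<omega>)) \<in> borel_measurable M"
  unfolding quad_def by (rule borel_measurable_scalar_prod_mult)

lemma integrable_mult_square_integrable:
  fixes f g :: "'a \<Rightarrow> real"
  assumes [measurable]: "f \<in> borel_measurable M" "g \<in> borel_measurable M"
    and "integrable M (\<lambda>x. (f x)\<^sup>2)" "integrable M (\<lambda>x. (g x)\<^sup>2)"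
  shows "integrable M (\<lambda>x. f x * g x)"
proof (rule Bochner_Integration.integrable_bound)
  show "integrable M (\<lambda>x. (f x)\<^sup>2 + (g x)\<^sup>2)" using assms by simp
  have "\<bar>a * b\<bar> \<le> a\<^sup>2 + b\<^sup>2" for a b :: real
    using sum_squares_bound[of "\<bar>a\<bar>" "\<bar>b\<bar>"] mult_nonneg_nonneg[of "\<bar>a\<bar>" "\<bar>b\<bar>"]
    by (simp only: abs_mult power2_abs) linarith
  then show "AE x in M. norm (f x * g x) \<le> norm ((f x)\<^sup>2 + (g x)\<^sup>2)" by simp
qed simp

section \<open>Square integrability and mixed second moments\<close>

definition square_integrable_vec :: "'a measure \<Rightarrow> nat \<Rightarrow> ('a \<Rightarrow> real vec) \<Rightarrow> bool" where
  "square_integrable_vec M n X \<longleftrightarrow>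
     X \<in> measurable M (borel_vec n) \<and> (\<forall>j<n. integrable M (\<lambda>\<omega>. (X \<omega> $ j)\<^sup>2))"

lemma square_integrable_vecD:
  assumes "square_integrable_vec M n X"
  shows "X \<in> measurable M (borel_vec n)"
    and "\<omega> \<in> space M \<Longrightarrow> X \<omega> \<in> carrier_vec n"
    and "j < n \<Longrightarrow> (\<lambda>\<omega>. X \<omega> $ j) \<in> borel_measurable M"
    and "j < n \<Longrightarrow> integrable M (\<lambda>\<omega>. (X \<omega> $ j)\<^sup>2)"
  using assms by (auto simp: square_integrable_vec_def measurable_borel_vec_iff)

lemma square_integrable_vec_prod:
  assumes "square_integrable_vec M n X" "square_integrable_vec M m Y" "i < n" "j < m"
  shows "integrable M (\<lambda>\<omega>. X \<omega> $ i * Y \<omega> $ j)"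
  using assms by (intro integrable_mult_square_integrable) (auto dest: square_integrable_vecD)

lemma square_integrable_vec_add:
  assumes "square_integrable_vec M n X" "square_integrable_vec M n Y"
  shows "square_integrable_vec M n (\<lambda>\<omega>. X \<omega> + Y \<omega>)"
  unfolding square_integrable_vec_def
proof (intro conjI allI impI)
  fix j assume j: "j < n"
  have "integrable M (\<lambda>\<omega>. (X \<omega> $ j)\<^sup>2 + (Y \<omega> $ j)\<^sup>2 + 2 * (X \<omega> $ j * Y \<omega> $ j))"
    using square_integrable_vec_prod[OF assms j j] assms j
    by (intro Bochner_Integration.integrable_add) (auto dest: square_integrable_vecD)
  then show "integrable M (\<lambda>\<omega>. ((X \<omega> + Y \<omega>) $ j)\<^sup>2)"
    by (rule Bochner_Integration.integrable_cong[THEN iffD1, rotated 2])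
      (use carrier_vecD[OF square_integrable_vecD(2)[OF assms(2)]] j in \<open>auto simp: power2_sum mult.assoc\<close>)
qed (use assms in \<open>auto intro: measurable_borel_vec_add dest: square_integrable_vecD\<close>)

lemma square_integrable_vec_diff:
  assumes "square_integrable_vec M n X" "square_integrable_vec M n Y"
  shows "square_integrable_vec M n (\<lambda>\<omega>. X \<omega> - Y \<omega>)"
  unfolding square_integrable_vec_def
proof (intro conjI allI impI)
  fix j assume j: "j < n"
  have "integrable M (\<lambda>\<omega>. (X \<omega> $ j)\<^sup>2 + (Y \<omega> $ j)\<^sup>2 - 2 * (X \<omega> $ j * Y \<omega> $ j))"
    using square_integrable_vec_prod[OF assms j j] assms j
    by (intro Bochner_Integration.integrable_add Bochner_Integration.integrable_diff) (auto dest: square_integrable_vecD)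
  then show "integrable M (\<lambda>\<omega>. ((X \<omega> - Y \<omega>) $ j)\<^sup>2)"
    by (rule Bochner_Integration.integrable_cong[THEN iffD1, rotated 2])
      (use carrier_vecD[OF square_integrable_vecD(2)[OF assms(2)]] j in \<open>auto simp: power2_diff mult.assoc\<close>)
qed (use assms in \<open>auto intro: measurable_borel_vec_diff dest: square_integrable_vecD\<close>)

lemma square_integrable_vec_mult:
  assumes "A \<in> carrier_mat n m" "square_integrable_vec M m X"
  shows "square_integrable_vec M n (\<lambda>\<omega>. A *\<^sub>v X \<omega>)"
  unfolding square_integrable_vec_def
proof (intro conjI allI impI)
  fix i assume i: "i < n"
  have "integrable M (\<lambda>\<omega>. \<Sum>j<m. \<Sum>k<m. A $$ (i, j) * A $$ (i, k) * (X \<omega> $ j * X \<omega> $ k))"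
    using square_integrable_vec_prod[OF assms(2,2)]
    by (intro Bochner_Integration.integrable_sum integrable_mult_right) auto
  then show "integrable M (\<lambda>\<omega>. ((A *\<^sub>v X \<omega>) $ i)\<^sup>2)"
    by (rule Bochner_Integration.integrable_cong[THEN iffD1, rotated 2])
      (use square_integrable_vecD(2)[OF assms(2)] i assms(1) in
        \<open>auto simp: index_mult_mat_vec_sum[of _ n m] power2_eq_square sum_product mult_ac simp del: index_mult_mat_vec intro!: sum.cong\<close>)
qed (use assms in \<open>auto intro: measurable_borel_vec_mult dest: square_integrable_vecD\<close>)

lemma square_integrable_vec_cong_AE:
  assumes "square_integrable_vec M n X" "Y \<in> measurable M (borel_vec n)" "AE \<omega> in M. Y \<omega> = X \<omega>"
  shows "square_integrable_vec M n Y"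
  unfolding square_integrable_vec_def
proof (intro conjI allI impI)
  fix j assume j: "j < n"
  show "integrable M (\<lambda>\<omega>. (Y \<omega> $ j)\<^sup>2)"
    using assms j
    by (intro integrable_cong_AE_imp[OF square_integrable_vecD(4)[OF assms(1) j]])
      (auto dest: measurable_borel_vecD)
qed (use assms in auto)

lemma integral_scalar_prod_mult:
  assumes "A \<in> carrier_mat n m" "square_integrable_vec M n X" "square_integrable_vec M m Y"
  shows "integrable M (\<lambda>\<omega>. X \<omega> \<bullet> (A *\<^sub>v Y \<omega>))"
    and "(\<integral>\<omega>. X \<omega> \<bullet> (A *\<^sub>v Y \<omega>) \<partial>M) = (\<Sum>i<n. \<Sum>j<m. A $$ (i, j) * (\<integral>\<omega>. X \<omega> $ i * Y \<omega> $ j \<partial>M))"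
proof -
  have eq: "X \<omega> \<bullet> (A *\<^sub>v Y \<omega>) = (\<Sum>i<n. \<Sum>j<m. A $$ (i, j) * (X \<omega> $ i * Y \<omega> $ j))"
    if "\<omega> \<in> space M" for \<omega>
    using assms that by (intro scalar_prod_mult_mat_vec_sum) (auto dest: square_integrable_vecD)
  note int = square_integrable_vec_prod[OF assms(2,3)]
  have "integrable M (\<lambda>\<omega>. \<Sum>i<n. \<Sum>j<m. A $$ (i, j) * (X \<omega> $ i * Y \<omega> $ j))"
    using int by (intro Bochner_Integration.integrable_sum integrable_mult_right) auto
  then show "integrable M (\<lambda>\<omega>. X \<omega> \<bullet> (A *\<^sub>v Y \<omega>))"
    by (rule Bochner_Integration.integrable_cong[THEN iffD1, rotated 2]) (auto simp: eq)
  have "(\<integral>\<omega>. X \<omega> \<bullet> (A *\<^sub>v Y \<omega>) \<partial>M) = (\<integral>\<omega>. (\<Sum>i<n. \<Sum>j<m. A $$ (i, j) * (X \<omega> $ i * Y \<omega> $ j)) \<partial>M)"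
    by (intro Bochner_Integration.integral_cong) (auto simp: eq)
  also have "\<dots> = (\<Sum>i<n. \<Sum>j<m. A $$ (i, j) * (\<integral>\<omega>. X \<omega> $ i * Y \<omega> $ j \<partial>M))"
    using int by (subst Bochner_Integration.integral_sum)
      (auto intro!: Bochner_Integration.integrable_sum integrable_mult_right sum.cong simp: Bochner_Integration.integral_sum)
  finally show "(\<integral>\<omega>. X \<omega> \<bullet> (A *\<^sub>v Y \<omega>) \<partial>M) = \<dots>" .
qed

lemma integral_quad:
  assumes "A \<in> carrier_mat n n" "square_integrable_vec M n X"
  shows "integrable M (\<lambda>\<omega>. quad A (X \<omega>))"
    and "(\<integral>\<omega>. quad A (X \<omega>) \<partial>M) = (\<Sum>i<n. \<Sum>j<n. A $$ (i, j) * (\<integral>\<omega>. X \<omega> $ i * X \<omega> $ j \<partial>M))"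
  using integral_scalar_prod_mult[OF assms(1,2,2)] by (auto simp: quad_def)

lemma integral_scalar_prod_mult_eq_0:
  assumes "A \<in> carrier_mat n m" "square_integrable_vec M n X" "square_integrable_vec M m Y"
    and "\<And>i j. i < n \<Longrightarrow> j < m \<Longrightarrow> (\<integral>\<omega>. X \<omega> $ i * Y \<omega> $ j \<partial>M) = 0"
  shows "(\<integral>\<omega>. X \<omega> \<bullet> (A *\<^sub>v Y \<omega>) \<partial>M) = 0"
  using assms(4) by (simp add: integral_scalar_prod_mult(2)[OF assms(1-3)])

lemma tr_mult:
  assumes "A \<in> carrier_mat n n" "B \<in> carrier_mat n n"
  shows "tr (A * B) = (\<Sum>i<n. \<Sum>j<n. A $$ (i, j) * B $$ (j, i))"
  using assms by (auto simp: tr_def scalar_prod_def atLeast0LessThan intro!: sum.cong)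

lemma tr_mult_comm:
  assumes "A \<in> carrier_mat n n" "B \<in> carrier_mat n n"
  shows "tr (A * B) = tr (B * A)"
  unfolding tr_mult[OF assms] tr_mult[OF assms(2,1)] by (subst sum.swap) (simp add: mult.commute)

text \<open>The indices of \<open>V\<close> are swapped to match the entries that
  \<open>tr_mult\<close> produces.\<close>

lemma integral_quad_tr:
  assumes "A \<in> carrier_mat n n" "square_integrable_vec M n X" "V \<in> carrier_mat n n"
    and "\<And>i j. i < n \<Longrightarrow> j < n \<Longrightarrow> (\<integral>\<omega>. X \<omega> $ i * X \<omega> $ j \<partial>M) = V $$ (j, i)"
  shows "(\<integral>\<omega>. quad A (X \<omega>) \<partial>M) = tr (A * V)"
  using assms(4) by (simp add: integral_quad(2)[OF assms(1,2)] tr_mult[OF assms(1,3)])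

section \<open>Gaussian moments, independence and conditional expectation\<close>

context prob_space
begin

text \<open>A point mass has no density, so variance zero is treated through almost sure equality
  with the mean.\<close>

lemma gaussian_real_moments:
  assumes "gaussian_real M X \<mu> s2"
  shows "integrable M X" "integrable M (\<lambda>\<omega>. (X \<omega>)\<^sup>2)" "expectation X = \<mu>" "expectation (\<lambda>\<omega>. (X \<omega> - \<mu>)\<^sup>2) = s2"
proof -
  have [measurable]: "X \<in> borel_measurable M" using assms by (simp add: gaussian_real_def)
  have "integrable M X \<and> integrable M (\<lambda>\<omega>. (X \<omega>)\<^sup>2) \<and> expectation X = \<mu> \<and> expectation (\<lambda>\<omega>. (X \<omega> - \<mu>)\<^sup>2) = s2"
  proof (cases "s2 = 0")
    case True
    then have *: "AE \<omega> in M. X \<omega> = \<mu>" using assms by (simp add: gaussian_real_def)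
    have "integrable M X" by (rule integrable_cong_AE_imp[of M "\<lambda>_. \<mu>"]) (use * in auto)
    moreover have "integrable M (\<lambda>\<omega>. (X \<omega>)\<^sup>2)"
      by (rule integrable_cong_AE_imp[of M "\<lambda>_. \<mu>\<^sup>2"]) (use * in auto)
    moreover have "expectation X = expectation (\<lambda>_. \<mu>)" by (rule integral_cong_AE) (use * in auto)
    moreover have "expectation (\<lambda>\<omega>. (X \<omega> - \<mu>)\<^sup>2) = expectation (\<lambda>_. 0)"
      by (rule integral_cong_AE) (use * in auto)
    ultimately show ?thesis using True by (simp add: prob_space)
  next
    case False
    then have s2: "s2 > 0" and D: "distributed M lborel X (\<lambda>x. ennreal (normal_density \<mu> (sqrt s2) x))"
      using assms by (auto simp: gaussian_real_def)
    have pos: "0 < sqrt s2" using s2 by simp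
    note E = normal_distributed_expectation[OF pos D]
    have i1: "integrable M X"
      using distributed_integrable_var[OF D] integrable_normal_moment_nz_1[OF pos] by simp
    have "integrable M (\<lambda>\<omega>. (X \<omega> - \<mu>)\<^sup>2)"
      using distributed_integrable[OF D, of "\<lambda>x. (x - \<mu>)\<^sup>2"] integrable_normal_moment[OF pos, of \<mu> 2] by simp
    \<comment> \<open>The added terms complete the square of \<open>X - \<mu>\<close> to the square
      of \<open>X\<close>.\<close>
    then have "integrable M (\<lambda>\<omega>. (X \<omega> - \<mu>)\<^sup>2 + (2 * \<mu> * X \<omega> - \<mu>\<^sup>2))" using i1 by auto
    then have "integrable M (\<lambda>\<omega>. (X \<omega>)\<^sup>2)" by (simp add: power2_diff mult_ac)
    then show ?thesis using E i1 normal_distributed_variance[OF pos D] s2 by simp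
  qed
  then show "integrable M X" "integrable M (\<lambda>\<omega>. (X \<omega>)\<^sup>2)" "expectation X = \<mu>" "expectation (\<lambda>\<omega>. (X \<omega> - \<mu>)\<^sup>2) = s2"
    by auto
qed

lemma gaussian_vec_square_integrable:
  assumes "gaussian_vec M n X \<mu> V"
  shows "square_integrable_vec M n X"
  unfolding square_integrable_vec_def
proof (intro conjI allI impI)
  show X: "X \<in> measurable M (borel_vec n)" using assms by (simp add: gaussian_vec_def)
  fix j assume j: "j < n"
  have "integrable M (\<lambda>\<omega>. (unit_vec n j \<bullet> X \<omega>)\<^sup>2)"
    using assms by (intro gaussian_real_moments(2)) (auto simp: gaussian_vec_def)
  then show "integrable M (\<lambda>\<omega>. (X \<omega> $ j)\<^sup>2)"
    by (rule Bochner_Integration.integrable_cong[THEN iffD1, rotated 2])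
      (use measurable_borel_vecD(1)[OF X] j in auto)
qed

lemma gaussian_vec_expectation:
  assumes "gaussian_vec M n X \<mu> V" "j < n"
  shows "expectation (\<lambda>\<omega>. X \<omega> $ j) = \<mu> $ j"
proof -
  have X: "X \<in> measurable M (borel_vec n)" using assms by (simp add: gaussian_vec_def)
  have "expectation (\<lambda>\<omega>. X \<omega> $ j) = expectation (\<lambda>\<omega>. unit_vec n j \<bullet> X \<omega>)"
    using measurable_borel_vecD(1)[OF X] assms(2) by (intro Bochner_Integration.integral_cong) auto
  also have "\<dots> = unit_vec n j \<bullet> \<mu>"
    using assms by (intro gaussian_real_moments(3)[of _ _ "quad V (unit_vec n j)"])
      (auto simp: gaussian_vec_def simp del: scalar_prod_left_unit)
  finally show ?thesis using assms by (simp add: gaussian_vec_def)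
qed

text \<open>\<open>gaussian_vec\<close> gives only the variances of linear functionals. Mixed
  moments follow by polarization, from \<open>unit_vec n i\<close>, \<open>unit_vec n j\<close> and
  their sum; with mean zero a variance is a second moment.\<close>

lemma gaussian_vec_second_moment:
  assumes "gaussian_vec M n X (0\<^sub>v n) V" "i < n" "j < n"
  shows "expectation (\<lambda>\<omega>. X \<omega> $ i * X \<omega> $ j) = V $$ (i, j)"
proof -
  note sq = gaussian_vec_square_integrable[OF assms(1)]
  have V: "V \<in> carrier_mat n n" "V\<^sup>T = V" using assms by (auto simp: gaussian_vec_def pos_semidef_def)
  have 1: "expectation (\<lambda>\<omega>. (a \<bullet> X \<omega>)\<^sup>2) = quad V a" if "a \<in> carrier_vec n" for a
    using assms that gaussian_real_moments(4)[of "\<lambda>\<omega>. a \<bullet> X \<omega>" "a \<bullet> 0\<^sub>v n" "quad V a"]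
    by (auto simp: gaussian_vec_def)
  have unit: "unit_vec n k \<bullet> (V *\<^sub>v unit_vec n l) = V $$ (k, l)" if "k < n" "l < n" for k l
    using V that by (auto simp: mult_mat_vec_def)
  have sym: "V $$ (j, i) = V $$ (i, j)"
    using V assms by (metis index_transpose_mat(1) carrier_matD)
  have d: "expectation (\<lambda>\<omega>. (X \<omega> $ k)\<^sup>2) = V $$ (k, k)" if k: "k < n" for k
  proof -
    have "expectation (\<lambda>\<omega>. (X \<omega> $ k)\<^sup>2) = expectation (\<lambda>\<omega>. (unit_vec n k \<bullet> X \<omega>)\<^sup>2)"
      using square_integrable_vecD(2)[OF sq] k by (intro Bochner_Integration.integral_cong) auto
    then show ?thesis using 1[of "unit_vec n k"] unit[OF k k] by (simp add: quad_def)
  qed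
  let ?a = "unit_vec n i + unit_vec n j"
  have "expectation (\<lambda>\<omega>. (X \<omega> $ i)\<^sup>2 + (X \<omega> $ j)\<^sup>2 + 2 * (X \<omega> $ i * X \<omega> $ j)) = expectation (\<lambda>\<omega>. (?a \<bullet> X \<omega>)\<^sup>2)"
    using square_integrable_vecD(2)[OF sq] assms(2,3)
    by (intro Bochner_Integration.integral_cong) (auto simp: add_scalar_prod_distrib[of _ n] power2_sum)
  also have "\<dots> = quad V ?a" by (rule 1) simp
  also have "\<dots> = V $$ (i, i) + V $$ (j, j) + 2 * V $$ (i, j)"
    using V assms(2,3) sym unfolding quad_def
    by (simp add: mult_add_distrib_mat_vec[of _ n n] add_scalar_prod_distrib[of _ n] scalar_prod_add_distrib[of _ n] unit
        del: scalar_prod_left_unit scalar_prod_right_unit)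
  finally show ?thesis
    using square_integrable_vec_prod[OF sq sq assms(2,3)] square_integrable_vecD(4)[OF sq] assms(2,3) d
    by simp
qed

text \<open>The \<sigma>-algebras generated by \<open>f\<close> and \<open>g\<close> lie in
  \<open>F1\<close> and \<open>F2\<close>, which reduces the claim to two independent real
  variables.\<close>

lemma expectation_indep_subalgebras:
  fixes f g :: "'a \<Rightarrow> real"
  assumes "indep_set (sets F1) (sets F2)" "space F1 = space M" "space F2 = space M"
    and f: "f \<in> borel_measurable F1" and g: "g \<in> borel_measurable F2" and "integrable M f" "integrable M g"
  shows "expectation (\<lambda>\<omega>. f \<omega> * g \<omega>) = expectation f * expectation g"
proof (rule indep_var_lebesgue_integral)
  let ?F = "\<lambda>f :: 'a \<Rightarrow> real. sigma_sets (space M) {f -` A \<inter> space M | A. A \<in> sets borel}"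
  have "?F f \<subseteq> sets F1"
    using measurable_sets[OF f] sets.sigma_sets_subset[of "{f -` A \<inter> space M | A. A \<in> sets borel}" F1]
    unfolding assms(2) by blast
  moreover have "?F g \<subseteq> sets F2"
    using measurable_sets[OF g] sets.sigma_sets_subset[of "{g -` A \<inter> space M | A. A \<in> sets borel}" F2]
    unfolding assms(3) by blast
  ultimately have "indep_set (?F f) (?F g)"
    using assms(1) unfolding indep_sets2_eq by blast
  then show "indep_var borel f borel g"
    unfolding indep_var_eq using assms(6,7) by (simp add: borel_measurable_integrable)
qed fact+

text \<open>Conditional Jensen inequality for the square.\<close>

lemma square_integrable_cond_exp:
  assumes "subalgebra M F" "f \<in> borel_measurable M" "integrable M (\<lambda>\<omega>. (f \<omega>)\<^sup>2)"
  shows "integrable M (\<lambda>\<omega>. (real_cond_exp M F f \<omega>)\<^sup>2)"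
proof -
  interpret finite_measure_subalgebra M F by unfold_locales fact
  show ?thesis
    using square_integrable_imp_integrable[OF assms(2,3)] assms(3) convex_power2
    by (intro integrable_convex_cond_exp[where I = UNIV]) auto
qed

text \<open>The defining property of conditional expectation with test function \<open>g\<close>;
  second moments of both factors make the product integrable.\<close>

lemma expectation_cond_exp_orthogonal:
  assumes "subalgebra M F" "g \<in> borel_measurable F" "integrable M (\<lambda>\<omega>. (g \<omega>)\<^sup>2)"
    and "f \<in> borel_measurable M" "integrable M (\<lambda>\<omega>. (f \<omega>)\<^sup>2)"
  shows "expectation (\<lambda>\<omega>. g \<omega> * (f \<omega> - real_cond_exp M F f \<omega>)) = 0"
proof -
  interpret finite_measure_subalgebra M F by unfold_locales fact
  have "integrable M (\<lambda>\<omega>. g \<omega> * f \<omega>)"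
    using assms by (intro integrable_mult_square_integrable) (auto dest: measurable_from_subalg)
  with real_cond_exp_intg[OF this assms(2,4)] show ?thesis
    by (simp add: right_diff_distrib)
qed

end

text \<open>Each sublevel set of \<open>f\<close> at a rational \<open>q\<close> is the preimage of
  some \<open>A q\<close>, and a real number is the infimum of the rationals not below it. The
  infimum of the \<open>q\<close> with \<open>y \<in> A q\<close> therefore recovers
  \<open>f\<close> on the range of \<open>h\<close>. Off that range the infimum may be infinite, so
  it is formed in \<open>ereal\<close> and converted at the end.\<close>

lemma doob_dynkin:
  fixes f :: "'a \<Rightarrow> real"
  assumes f: "f \<in> borel_measurable (vimage_algebra X h N)" and h: "h \<in> X \<rightarrow> space N"
  shows "\<exists>g \<in> borel_measurable N. \<forall>x\<in>X. f x = g (h x)"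
proof -
  have "\<exists>A \<in> sets N. {x \<in> X. f x \<le> of_rat q} = h -` A \<inter> X" for q
  proof -
    have "{x \<in> space (vimage_algebra X h N). f x \<le> of_rat q} \<in> sets (vimage_algebra X h N)"
      using f by measurable
    then show ?thesis by (auto simp: sets_vimage_algebra2[OF h])
  qed
  then obtain A where A: "\<And>q. A q \<in> sets N" "\<And>q. {x \<in> X. f x \<le> of_rat q} = h -` A q \<inter> X"
    by metis
  have A': "h x \<in> A q \<longleftrightarrow> f x \<le> of_rat q" if "x \<in> X" for x q
    using A(2)[of q] that by auto
  let ?g = "\<lambda>y. INF q. if y \<in> A q then ereal (of_rat q) else \<infinity>"
  have g: "?g \<in> borel_measurable N" using A(1) by measurable
  have "?g (h x) = ereal (f x)" if x: "x \<in> X" for x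
  proof (rule antisym)
    show "ereal (f x) \<le> ?g (h x)" by (rule INF_greatest) (auto simp: A'[OF x])
    show "?g (h x) \<le> ereal (f x)"
    proof (rule dense_ge)
      fix y assume "ereal (f x) < y"
      then obtain r where r: "f x < r" "ereal r < y" using ereal_dense2 by (metis ereal_less(2) less_ereal.simps(1))
      obtain q where q: "f x < of_rat q" "of_rat q < r" using of_rat_dense[OF r(1)] by auto
      have "?g (h x) \<le> (if h x \<in> A q then ereal (of_rat q) else \<infinity>)" by (rule INF_lower) simp
      also have "\<dots> \<le> ereal r" using q by (simp add: A'[OF x])
      finally show "?g (h x) \<le> y" using r by simp
    qed
  qed
  then show ?thesis using g by (intro bexI[of _ "\<lambda>y. real_of_ereal (?g y)"]) auto
qed

section \<open>Measurability of the closed loop\<close>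

locale lqg_system =
  fixes G :: "('w, 'i) lqg"
  assumes lqg: "lqg_setting G"
begin

abbreviation "M \<equiv> prob_sp G"
abbreviation "T \<equiv> horizon G"
abbreviation "n \<equiv> dimx G"

sublocale prob_space M
  using lqg by (simp add: lqg_setting_def)

lemma system_carrier:
  assumes "t \<in> {1..T}"
  shows "sys_A G t \<in> carrier_mat n n" "sys_B G t \<in> carrier_mat n (dimu G t)"
    "pos_semidef n (wt_Q G t)" "pos_def (dimu G t) (wt_R G t)"
    "gaussian_vec M n (proc_w G t) (0\<^sub>v n) (proc_cov G t)"
  using lqg assms by (auto simp: lqg_setting_def)

lemma sensor_carrier:
  assumes "i \<in> sensors G" "t \<in> {1..T}"
  shows "sens_C G i t \<in> carrier_mat (dimy G i t) n"
    "meas_v G i t \<in> measurable M (borel_vec (dimy G i t))"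
  using lqg assms by (auto simp: lqg_setting_def gaussian_vec_def)

lemma init_gaussian: "gaussian_vec M n (init_x G) (init_mean G) (init_cov G)"
  using lqg by (simp add: lqg_setting_def)

lemma init_measurable: "init_x G \<in> measurable M (borel_vec n)"
  using init_gaussian by (simp add: gaussian_vec_def)

lemma proc_measurable: "t \<in> {1..T} \<Longrightarrow> proc_w G t \<in> measurable M (borel_vec n)"
  using system_carrier(5) by (simp add: gaussian_vec_def)

lemma history_measurable:
  assumes "\<And>s i. s \<in> {1..t} \<Longrightarrow> i \<in> S \<Longrightarrow> reading G S u i s \<in> measurable N (borel_vec (dimy G i s))"
  shows "history G S u t \<in> measurable N (obs_space G S t)"
  unfolding history_def[abs_def] obs_space_def
  by (intro measurable_restrict) (use assms in auto)

lemma control_measurable: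
  assumes "is_policy G S u" "t \<in> {1..T}" "history G S u t \<in> measurable N (obs_space G S t)"
  shows "control G S u t \<in> measurable N (borel_vec (dimu G t))"
proof -
  have "u t \<in> measurable (obs_space G S t) (borel_vec (dimu G t))"
    using assms by (auto simp: is_policy_def)
  from measurable_compose[OF assms(3) this] show ?thesis by (simp add: control_def[abs_def])
qed

text \<open>\<open>N\<close> is left open for two uses: the whole probability space, and the
  \<sigma>-algebra of the initial state, the measurement noises and the process noises strictly
  before \<open>t\<close>. The second use expresses that the state does not anticipate
  \<open>proc_w G t\<close>.\<close>

lemma state_measurable:
  assumes u: "is_policy G S u" and S: "S \<subseteq> sensors G"
    and init: "init_x G \<in> measurable N (borel_vec n)"
    and noise: "\<And>s i. s \<in> {1..T} \<Longrightarrow> i \<in> S \<Longrightarrow> meas_v G i s \<in> measurable N (borel_vec (dimy G i s))"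
    and proc: "\<And>s. s \<in> {1..<t} \<Longrightarrow> proc_w G s \<in> measurable N (borel_vec n)"
    and t: "1 \<le> t" "t \<le> T + 1"
  shows "state G S u t \<in> measurable N (borel_vec n)"
proof -
  \<comment> \<open>Strong induction, since the control at a time reads every state up to that
    time.\<close>
  have "1 \<le> s \<Longrightarrow> s \<le> t \<Longrightarrow> state G S u s \<in> measurable N (borel_vec n)" for s
  proof (induction s rule: less_induct)
    case (less s)
    show ?case
    proof (cases "s = 1")
      case True
      moreover have "state G S u 1 = init_x G" by (rule ext) (rule state_1)
      ultimately show ?thesis using init by metis
    next
      case False
      define r where "r = s - 1"
      have r: "s = r + 1" "1 \<le> r" "r \<in> {1..T}" "r < t"
        using False less.prems t by (auto simp: r_def)
      have st: "state G S u q \<in> measurable N (borel_vec n)" if "q \<in> {1..r}" for q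
        using that less.prems r by (intro less.IH) auto
      have "reading G S u i q \<in> measurable N (borel_vec (dimy G i q))" if "q \<in> {1..r}" "i \<in> S" for q i
        unfolding reading_def[abs_def] using that r S
        by (intro measurable_borel_vec_add measurable_borel_vec_mult[OF sensor_carrier(1)] st noise) auto
      then have "control G S u r \<in> measurable N (borel_vec (dimu G r))"
        using control_measurable[OF u r(3) history_measurable] by blast
      then have "(\<lambda>\<omega>. sys_A G r *\<^sub>v state G S u r \<omega> + sys_B G r *\<^sub>v control G S u r \<omega> + proc_w G r \<omega>)
          \<in> measurable N (borel_vec n)"
        using r by (intro measurable_borel_vec_add measurable_borel_vec_mult[OF system_carrier(1)]
            measurable_borel_vec_mult[OF system_carrier(2)] st proc) auto
      then show ?thesis unfolding r(1) by (simp only: state_Suc[OF r(2), abs_def])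
    qed
  qed
  then show ?thesis using t by simp
qed

lemma reading_measurable:
  assumes "is_policy G S u" "S \<subseteq> sensors G"
    and "init_x G \<in> measurable N (borel_vec n)"
    and noise: "\<And>s i. s \<in> {1..T} \<Longrightarrow> i \<in> S \<Longrightarrow> meas_v G i s \<in> measurable N (borel_vec (dimy G i s))"
    and "\<And>s. s \<in> {1..<t} \<Longrightarrow> proc_w G s \<in> measurable N (borel_vec n)"
    and "t \<in> {1..T}" "i \<in> S"
  shows "reading G S u i t \<in> measurable N (borel_vec (dimy G i t))"
  unfolding reading_def[abs_def]
proof (intro measurable_borel_vec_add measurable_borel_vec_mult noise)
  show "state G S u t \<in> measurable N (borel_vec n)" using assms by (intro state_measurable) auto
  show "sens_C G i t \<in> carrier_mat (dimy G i t) n" using assms by (intro sensor_carrier) auto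
qed (use assms in auto)

section \<open>The \<sigma>-algebra of the observations\<close>

definition obs_algebra :: "'i set \<Rightarrow> 'i policy \<Rightarrow> nat \<Rightarrow> 'w measure" where
  "obs_algebra S u t = vimage_algebra (space M) (history G S u t) (obs_space G S t)"

lemma space_obs_algebra [simp]: "space (obs_algebra S u t) = space M"
  by (simp add: obs_algebra_def)

context
  fixes S :: "'i set"
  assumes S: "S \<subseteq> sensors G"
begin

lemma state_measurable_M:
  assumes "is_policy G S u" "1 \<le> t" "t \<le> T + 1"
  shows "state G S u t \<in> measurable M (borel_vec n)"
  using assms S by (intro state_measurable init_measurable proc_measurable sensor_carrier(2)) auto

lemma history_measurable_M:
  assumes "is_policy G S u" "t \<le> T"
  shows "history G S u t \<in> measurable M (obs_space G S t)"
  using assms S by (intro history_measurable reading_measurable init_measurable proc_measurable sensor_carrier(2)) auto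

lemma control_measurable_M:
  assumes "is_policy G S u" "t \<in> {1..T}"
  shows "control G S u t \<in> measurable M (borel_vec (dimu G t))"
  using assms by (intro control_measurable[OF assms] history_measurable_M) auto

lemma history_measurable_obs_algebra:
  assumes "is_policy G S u" "t \<le> T"
  shows "history G S u t \<in> measurable (obs_algebra S u t) (obs_space G S t)"
  unfolding obs_algebra_def
  by (rule measurable_vimage_algebra1) (use measurable_space[OF history_measurable_M[OF assms]] in auto)

lemma subalgebra_obs_algebra:
  assumes "is_policy G S u" "t \<le> T"
  shows "subalgebra M (obs_algebra S u t)"
proof -
  note h = history_measurable_M[OF assms]
  have "history G S u t \<in> space M \<rightarrow> space (obs_space G S t)" using measurable_space[OF h] by auto
  then show ?thesis
    using measurable_sets[OF h] by (auto simp: subalgebra_def obs_algebra_def sets_vimage_algebra2)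
qed

lemma reading_measurable_obs_algebra:
  assumes "is_policy G S u" "t \<le> T" "s \<in> {1..t}" "i \<in> S"
  shows "reading G S u i s \<in> measurable (obs_algebra S u t) (borel_vec (dimy G i s))"
proof -
  note h = history_measurable_obs_algebra[OF assms(1,2), unfolded obs_space_def]
  from measurable_compose[OF measurable_compose[OF h measurable_component_singleton[OF assms(3)]]
      measurable_component_singleton[OF assms(4)]]
  show ?thesis using assms(3,4) by (simp add: history_def)
qed

lemma history_restrict_measurable_obs_algebra:
  assumes "is_policy G S u" "t \<le> T" "s \<le> t"
  shows "history G S u s \<in> measurable (obs_algebra S u t) (obs_space G S s)"
  using assms by (intro history_measurable reading_measurable_obs_algebra) auto

text \<open>Both loops see the same measurement noise, so their readings differ by
  \<open>sens_C G i q\<close> applied to the difference of the states.\<close>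

lemma reading_measurable_if_state_diff:
  assumes u: "is_policy G S u" and u': "is_policy G S u'" and t: "t \<le> T" and q: "q \<in> {1..t}" and i: "i \<in> S"
    and diff: "(\<lambda>\<omega>. state G S u q \<omega> - state G S u' q \<omega>) \<in> measurable (obs_algebra S u' t) (borel_vec n)"
  shows "reading G S u i q \<in> measurable (obs_algebra S u' t) (borel_vec (dimy G i q))"
proof -
  have C: "sens_C G i q \<in> carrier_mat (dimy G i q) n" and v: "meas_v G i q \<in> measurable M (borel_vec (dimy G i q))"
    using q i S t sensor_carrier[of i q] by auto
  have "(\<lambda>\<omega>. reading G S u' i q \<omega> + sens_C G i q *\<^sub>v (state G S u q \<omega> - state G S u' q \<omega>))
      \<in> measurable (obs_algebra S u' t) (borel_vec (dimy G i q))"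
    using q i t by (intro measurable_borel_vec_add measurable_borel_vec_mult[OF C] diff
        reading_measurable_obs_algebra[OF u']) auto
  moreover have "reading G S u' i q \<omega> + sens_C G i q *\<^sub>v (state G S u q \<omega> - state G S u' q \<omega>) = reading G S u i q \<omega>"
    if "\<omega> \<in> space M" for \<omega>
  proof -
    have x: "state G S u q \<omega> \<in> carrier_vec n" "state G S u' q \<omega> \<in> carrier_vec n"
      using measurable_borel_vecD(1)[OF state_measurable_M that] q t u u' by auto
    have "meas_v G i q \<omega> \<in> carrier_vec (dimy G i q)" using v that by (rule measurable_borel_vecD)
    then show ?thesis unfolding reading_def
      using C x by (simp add: mult_minus_distrib_mat_vec[of _ _ n] del: index_mult_mat_vec) (auto intro!: eq_vecI simp del: index_mult_mat_vec)
  qed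
  ultimately show ?thesis by (rule measurable_cong[THEN iffD1, rotated]) simp
qed

text \<open>
  The controls are known to the observer, so two policies on the same sensors produce states that
  differ by a quantity that either of them can compute from its own history.
\<close>

lemma state_diff_measurable:
  assumes u: "is_policy G S u" and u': "is_policy G S u'" and t: "t \<le> T" and s: "1 \<le> s" "s \<le> t + 1"
  shows "(\<lambda>\<omega>. state G S u s \<omega> - state G S u' s \<omega>) \<in> measurable (obs_algebra S u' t) (borel_vec n)"
  using s
proof (induction s rule: less_induct)
  case (less s)
  let ?F = "obs_algebra S u' t"
  show ?case
  proof (cases "s = 1")
    case True
    \<comment> \<open>Both loops start from \<open>init_x G\<close>, so the first difference
      vanishes.\<close>
    have "(\<lambda>\<omega>. 0\<^sub>v n) \<in> measurable ?F (borel_vec n)" by simp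
    moreover have "0\<^sub>v n = state G S u s \<omega> - state G S u' s \<omega>" if "\<omega> \<in> space M" for \<omega>
      using measurable_borel_vecD(1)[OF init_measurable that]
      by (simp only: True state_1) (auto intro!: eq_vecI)
    ultimately show ?thesis by (rule measurable_cong[THEN iffD1, rotated]) simp
  next
    case False
    define r where "r = s - 1"
    have r: "s = r + 1" "1 \<le> r" "r \<in> {1..T}" "r \<le> t"
      using False less.prems t by (auto simp: r_def)
    have diff: "(\<lambda>\<omega>. state G S u q \<omega> - state G S u' q \<omega>) \<in> measurable ?F (borel_vec n)" if "q \<in> {1..r}" for q
      using that less.prems r by (intro less.IH) auto
    have "reading G S u i q \<in> measurable ?F (borel_vec (dimy G i q))" if "q \<in> {1..r}" "i \<in> S" for q i
      using that r by (intro reading_measurable_if_state_diff[OF u u' t] diff) auto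
    then have "history G S u r \<in> measurable ?F (obs_space G S r)" by (rule history_measurable)
    then have cu: "control G S u r \<in> measurable ?F (borel_vec (dimu G r))"
      by (rule control_measurable[OF u r(3)])
    have cu': "control G S u' r \<in> measurable ?F (borel_vec (dimu G r))"
      by (rule control_measurable[OF u' r(3) history_restrict_measurable_obs_algebra[OF u' t r(4)]])
    \<comment> \<open>\<open>proc_w G r\<close> is the same in both loops and cancels. The control
      of \<open>u\<close> is observable to \<open>u'\<close> because it acts on readings that the
      induction hypothesis has made observable.\<close>
    have "(\<lambda>\<omega>. sys_A G r *\<^sub>v (state G S u r \<omega> - state G S u' r \<omega>) + sys_B G r *\<^sub>v (control G S u r \<omega> - control G S u' r \<omega>))
        \<in> measurable ?F (borel_vec n)"
      using r by (intro measurable_borel_vec_add measurable_borel_vec_mult[OF system_carrier(1)]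
          measurable_borel_vec_mult[OF system_carrier(2)] diff measurable_borel_vec_diff[OF cu cu']) auto
    moreover have "sys_A G r *\<^sub>v (state G S u r \<omega> - state G S u' r \<omega>) + sys_B G r *\<^sub>v (control G S u r \<omega> - control G S u' r \<omega>)
        = state G S u s \<omega> - state G S u' s \<omega>" if w: "\<omega> \<in> space M" for \<omega>
    proof -
      have x: "state G S u r \<omega> \<in> carrier_vec n" "state G S u' r \<omega> \<in> carrier_vec n"
        using measurable_borel_vecD(1)[OF state_measurable_M w] r u u' by auto
      have c: "control G S u r \<omega> \<in> carrier_vec (dimu G r)" "control G S u' r \<omega> \<in> carrier_vec (dimu G r)"
        using measurable_borel_vecD(1)[OF cu] measurable_borel_vecD(1)[OF cu'] w by auto
      have p: "proc_w G r \<omega> \<in> carrier_vec n"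
        using proc_measurable[OF r(3)] w by (rule measurable_borel_vecD)
      show ?thesis unfolding r(1) state_Suc[OF r(2)]
        using x c p system_carrier(1,2)[OF r(3)]
        by (simp add: mult_minus_distrib_mat_vec[of _ _ n] mult_minus_distrib_mat_vec[of _ _ "dimu G r"] del: index_mult_mat_vec)
          (auto intro!: eq_vecI simp del: index_mult_mat_vec)
    qed
    ultimately show ?thesis by (rule measurable_cong[THEN iffD1, rotated]) simp
  qed
qed

lemma sets_obs_algebra_subset:
  assumes u: "is_policy G S u" and u': "is_policy G S u'" and t: "t \<le> T"
  shows "sets (obs_algebra S u t) \<subseteq> sets (obs_algebra S u' t)"
proof -
  have "reading G S u i q \<in> measurable (obs_algebra S u' t) (borel_vec (dimy G i q))" if "q \<in> {1..t}" "i \<in> S" for q i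
    using that by (intro reading_measurable_if_state_diff[OF u u' t] state_diff_measurable[OF u u' t]) auto
  then have h: "history G S u t \<in> measurable (obs_algebra S u' t) (obs_space G S t)"
    by (rule history_measurable)
  have "history G S u t \<in> space M \<rightarrow> space (obs_space G S t)"
    using measurable_space[OF h] by auto
  then show ?thesis
    using measurable_sets[OF h] by (auto simp: obs_algebra_def[of S u] sets_vimage_algebra2)
qed

text \<open>Inclusion holds both ways by symmetry. Equality is stated for the measures, both of them
  zero, so that it can be rewritten inside \<open>real_cond_exp\<close>.\<close>

lemma obs_algebra_eq:
  assumes "is_policy G S u" "is_policy G S u'" "t \<le> T"
  shows "obs_algebra S u t = obs_algebra S u' t"
proof (rule measure_eqI)
  show "sets (obs_algebra S u t) = sets (obs_algebra S u' t)"
    using sets_obs_algebra_subset assms by blast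
qed (simp add: obs_algebra_def vimage_algebra_def emeasure_sigma)

end

end

section \<open>The estimation error\<close>

context lqg_system
begin

text \<open>Only the controls are constrained: second moments of the states then follow from those
  of the initial state and the noise, by linearity of the dynamics.\<close>

definition square_integrable_policy :: "'i set \<Rightarrow> 'i policy \<Rightarrow> bool" where
  "square_integrable_policy S u \<longleftrightarrow>
     is_policy G S u \<and> (\<forall>t\<in>{1..T}. square_integrable_vec M (dimu G t) (control G S u t))"

lemma proc_square_integrable: "t \<in> {1..T} \<Longrightarrow> square_integrable_vec M n (proc_w G t)"
  using gaussian_vec_square_integrable[OF system_carrier(5)] .

text \<open>Asking only for the controls before \<open>t\<close> allows an induction in which the
  state at \<open>t\<close> serves to bound the control at \<open>t\<close>.\<close>

lemma state_square_integrable: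
  assumes "1 \<le> t" "t \<le> T + 1"
    and c: "\<And>s. s \<in> {1..<t} \<Longrightarrow> square_integrable_vec M (dimu G s) (control G S u s)"
  shows "square_integrable_vec M n (state G S u t)"
proof -
  have "s \<le> t \<Longrightarrow> square_integrable_vec M n (state G S u s)" if "1 \<le> s" for s
    using that
  proof (induction s rule: dec_induct)
    case base
    have "state G S u 1 = init_x G" by (rule ext) (rule state_1)
    then show ?case using gaussian_vec_square_integrable[OF init_gaussian] by metis
  next
    case (step s)
    then have s: "s \<in> {1..T}" "s \<in> {1..<t}" using assms by auto
    have "square_integrable_vec M n
        (\<lambda>\<omega>. sys_A G s *\<^sub>v state G S u s \<omega> + sys_B G s *\<^sub>v control G S u s \<omega> + proc_w G s \<omega>)"
      using step s by (intro square_integrable_vec_add square_integrable_vec_mult[OF system_carrier(1)]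
          square_integrable_vec_mult[OF system_carrier(2)] proc_square_integrable c) auto
    moreover have "state G S u (Suc s) =
        (\<lambda>\<omega>. sys_A G s *\<^sub>v state G S u s \<omega> + sys_B G s *\<^sub>v control G S u s \<omega> + proc_w G s \<omega>)"
      using state_Suc[of s] s(1) by (intro ext) simp
    ultimately show ?case by simp
  qed
  then show ?thesis using assms(1) by simp
qed

lemma square_integrable_policyD:
  assumes "square_integrable_policy S u"
  shows "is_policy G S u"
    and "t \<in> {1..T} \<Longrightarrow> square_integrable_vec M (dimu G t) (control G S u t)"
    and "1 \<le> t \<Longrightarrow> t \<le> T + 1 \<Longrightarrow> square_integrable_vec M n (state G S u t)"
  using assms by (auto simp: square_integrable_policy_def intro!: state_square_integrable)

lemma kalman_est_eq:
  "kalman_est G S u t \<omega> = vec n (\<lambda>j. real_cond_exp M (obs_algebra S u t) (\<lambda>\<omega>. state G S u t \<omega> $ j) \<omega>)"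
  by (simp add: kalman_est_def obs_algebra_def)

lemma kalman_est_measurable: "kalman_est G S u t \<in> measurable (obs_algebra S u t) (borel_vec n)"
  by (auto simp: measurable_borel_vec_iff kalman_est_eq)

context
  fixes S :: "'i set"
  assumes S: "S \<subseteq> sensors G"
begin

lemma kalman_est_square_integrable:
  assumes "is_policy G S u" "t \<le> T" "square_integrable_vec M n (state G S u t)"
  shows "square_integrable_vec M n (kalman_est G S u t)"
  unfolding square_integrable_vec_def
proof (intro conjI allI impI)
  note sub = subalgebra_obs_algebra[OF S assms(1,2)]
  show "kalman_est G S u t \<in> measurable M (borel_vec n)"
    by (rule measurable_from_subalg[OF sub kalman_est_measurable])
  fix j assume "j < n"
  then show "integrable M (\<lambda>\<omega>. (kalman_est G S u t \<omega> $ j)\<^sup>2)"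
    using square_integrable_cond_exp[OF sub square_integrable_vecD(3,4)[OF assms(3)]]
    by (simp add: kalman_est_eq)
qed

lemma estimation_error_orthogonal:
  assumes "is_policy G S u" "t \<le> T" "square_integrable_vec M n (state G S u t)"
    and "f \<in> borel_measurable (obs_algebra S u t)" "integrable M (\<lambda>\<omega>. (f \<omega>)\<^sup>2)" "j < n"
  shows "expectation (\<lambda>\<omega>. f \<omega> * (state G S u t \<omega> - kalman_est G S u t \<omega>) $ j) = 0"
  using expectation_cond_exp_orthogonal[OF subalgebra_obs_algebra[OF S assms(1,2)] assms(4,5)
      square_integrable_vecD(3,4)[OF assms(3,6)]] assms(6)
  by (simp add: kalman_est_eq)

text \<open>The difference of the two states is measurable for the common observation algebra, so it
  is its own conditional expectation, and subtracting the estimates removes it.\<close>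

lemma estimation_error_policy_independent:
  assumes u: "is_policy G S u" and u': "is_policy G S u'" and t: "t \<in> {1..T}"
    and sq: "square_integrable_vec M n (state G S u t)" "square_integrable_vec M n (state G S u' t)"
  shows "AE \<omega> in M. \<forall>j<n. state G S u t \<omega> $ j - kalman_est G S u t \<omega> $ j
    = state G S u' t \<omega> $ j - kalman_est G S u' t \<omega> $ j"
proof -
  have t': "1 \<le> t" "t \<le> T" using t by auto
  let ?F = "obs_algebra S u' t"
  have F: "obs_algebra S u t = ?F" by (rule obs_algebra_eq[OF S u u' t'(2)])
  interpret finite_measure_subalgebra M ?F
    by unfold_locales (rule subalgebra_obs_algebra[OF S u' t'(2)])
  have "AE \<omega> in M. state G S u t \<omega> $ j - kalman_est G S u t \<omega> $ j
    = state G S u' t \<omega> $ j - kalman_est G S u' t \<omega> $ j" if j: "j < n" for j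
  proof -
    have int: "integrable M (\<lambda>\<omega>. state G S u t \<omega> $ j)" "integrable M (\<lambda>\<omega>. state G S u' t \<omega> $ j)"
      using square_integrable_imp_integrable[OF square_integrable_vecD(3,4)[OF sq(1) j]]
        square_integrable_imp_integrable[OF square_integrable_vecD(3,4)[OF sq(2) j]] by auto
    have "(\<lambda>\<omega>. (state G S u t \<omega> - state G S u' t \<omega>) $ j) \<in> borel_measurable ?F"
      by (rule measurable_borel_vecD(2)[OF state_diff_measurable[OF S u u' t'(2)] j]) (use t' in auto)
    then have meas: "(\<lambda>\<omega>. state G S u t \<omega> $ j - state G S u' t \<omega> $ j) \<in> borel_measurable ?F"
      by (rule measurable_cong[THEN iffD1, rotated])
        (use carrier_vecD[OF square_integrable_vecD(2)[OF sq(2)]] j in auto)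
    show ?thesis
      using real_cond_exp_diff[OF int] real_cond_exp_F_meas[OF Bochner_Integration.integrable_diff[OF int] meas]
      by eventually_elim (use j in \<open>simp add: kalman_est_eq F\<close>)
  qed
  then show ?thesis by (simp add: AE_all_countable)
qed

lemma err_cov_policy_independent:
  assumes u: "is_policy G S u" and u': "is_policy G S u'" and t: "t \<in> {1..T}"
    and sq: "square_integrable_vec M n (state G S u t)" "square_integrable_vec M n (state G S u' t)"
  shows "err_cov G S u t = err_cov G S u' t"
  unfolding err_cov_def
proof (intro cong_mat refl, clarsimp)
  fix j k assume jk: "j < n" "k < n"
  have *: "(\<lambda>\<omega>. state G S v t \<omega> $ i - kalman_est G S v t \<omega> $ i) \<in> borel_measurable M"
    if "i < n" "square_integrable_vec M n (state G S v t)" "is_policy G S v" for i v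
    using that t kalman_est_square_integrable[of v t]
    by (intro borel_measurable_diff square_integrable_vecD(3)) auto
  show "(\<integral>\<omega>. (state G S u t \<omega> $ j - kalman_est G S u t \<omega> $ j) * (state G S u t \<omega> $ k - kalman_est G S u t \<omega> $ k) \<partial>M)
    = (\<integral>\<omega>. (state G S u' t \<omega> $ j - kalman_est G S u' t \<omega> $ j) * (state G S u' t \<omega> $ k - kalman_est G S u' t \<omega> $ k) \<partial>M)"
  proof (rule integral_cong_AE)
    show "AE \<omega> in M. (state G S u t \<omega> $ j - kalman_est G S u t \<omega> $ j) * (state G S u t \<omega> $ k - kalman_est G S u t \<omega> $ k)
      = (state G S u' t \<omega> $ j - kalman_est G S u' t \<omega> $ j) * (state G S u' t \<omega> $ k - kalman_est G S u' t \<omega> $ k)"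
      using estimation_error_policy_independent[OF u u' t sq] by eventually_elim (use jk in simp)
  qed (use * u u' jk sq in \<open>auto intro!: borel_measurable_times\<close>)
qed

text \<open>With \<open>k\<close> the estimate, \<open>c - L x = (c - L k) - L (x - k)\<close>. The
  first part is a function of the history and the estimation error is orthogonal to it, so the mixed
  term has mean zero.\<close>

lemma expectation_quad_separation:
  assumes u: "square_integrable_policy S u" and t: "t \<in> {1..T}"
    and Q: "Q \<in> carrier_mat (dimu G t) (dimu G t)" "Q\<^sup>T = Q" and L: "L \<in> carrier_mat (dimu G t) n"
  shows "expectation (\<lambda>\<omega>. quad Q (control G S u t \<omega> - L *\<^sub>v state G S u t \<omega>)) =
    expectation (\<lambda>\<omega>. quad Q (control G S u t \<omega> - L *\<^sub>v kalman_est G S u t \<omega>)) + tr (L\<^sup>T * Q * L * err_cov G S u t)"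
proof -
  let ?m = "dimu G t" and ?x = "state G S u t" and ?k = "kalman_est G S u t" and ?c = "control G S u t"
  have t': "1 \<le> t" "t \<le> T" "t \<le> T + 1" using t by auto
  note pol = square_integrable_policyD(1)[OF u]
  note c = square_integrable_policyD(2)[OF u t] and x = square_integrable_policyD(3)[OF u t'(1,3)]
  note k = kalman_est_square_integrable[OF pol t'(2) x]
  let ?a = "\<lambda>\<omega>. ?c \<omega> - L *\<^sub>v ?k \<omega>" and ?e = "\<lambda>\<omega>. ?x \<omega> - ?k \<omega>"
  have a: "square_integrable_vec M ?m ?a"
    by (rule square_integrable_vec_diff[OF c square_integrable_vec_mult[OF L k]])
  have e: "square_integrable_vec M n ?e" by (rule square_integrable_vec_diff[OF x k])
  have am: "?a \<in> measurable (obs_algebra S u t) (borel_vec ?m)"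
    by (intro measurable_borel_vec_diff measurable_borel_vec_mult[OF L] kalman_est_measurable
        control_measurable[OF pol t] history_measurable_obs_algebra[OF S pol t'(2)])
  have QL: "Q * L \<in> carrier_mat ?m n" and LQL: "L\<^sup>T * Q * L \<in> carrier_mat n n" using Q L by auto
  have eq: "quad Q (?c \<omega> - L *\<^sub>v ?x \<omega>) = quad Q (?a \<omega>) - 2 * (?a \<omega> \<bullet> ((Q * L) *\<^sub>v ?e \<omega>)) + quad (L\<^sup>T * Q * L) (?e \<omega>)"
    if w: "\<omega> \<in> space M" for \<omega>
  proof -
    have car: "?c \<omega> \<in> carrier_vec ?m" "?x \<omega> \<in> carrier_vec n" "?k \<omega> \<in> carrier_vec n"
      "?a \<omega> \<in> carrier_vec ?m" "?e \<omega> \<in> carrier_vec n"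
      using square_integrable_vecD(2)[OF c w] square_integrable_vecD(2)[OF x w] square_integrable_vecD(2)[OF k w]
        square_integrable_vecD(2)[OF a w] square_integrable_vecD(2)[OF e w] by auto
    have "?c \<omega> - L *\<^sub>v ?x \<omega> = ?a \<omega> - L *\<^sub>v ?e \<omega>"
      using car L by (simp add: mult_minus_distrib_mat_vec[of _ _ n] del: index_mult_mat_vec)
        (auto intro!: eq_vecI simp del: index_mult_mat_vec)
    moreover have "quad Q (?a \<omega> - L *\<^sub>v ?e \<omega>) = quad Q (?a \<omega>) - 2 * (?a \<omega> \<bullet> (Q *\<^sub>v (L *\<^sub>v ?e \<omega>))) + quad Q (L *\<^sub>v ?e \<omega>)"
      by (rule quad_diff[OF Q car(4)]) (use L car in auto)
    ultimately show ?thesis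
      using quad_mult_transpose[OF Q(1) L car(5)] assoc_mult_mat_vec[OF Q(1) L car(5)] by simp
  qed
  have "expectation (\<lambda>\<omega>. quad Q (?c \<omega> - L *\<^sub>v ?x \<omega>)) =
      expectation (\<lambda>\<omega>. quad Q (?a \<omega>) - 2 * (?a \<omega> \<bullet> ((Q * L) *\<^sub>v ?e \<omega>)) + quad (L\<^sup>T * Q * L) (?e \<omega>))"
    by (intro Bochner_Integration.integral_cong refl eq)
  also have "\<dots> = expectation (\<lambda>\<omega>. quad Q (?a \<omega>)) - 2 * expectation (\<lambda>\<omega>. ?a \<omega> \<bullet> ((Q * L) *\<^sub>v ?e \<omega>))
      + expectation (\<lambda>\<omega>. quad (L\<^sup>T * Q * L) (?e \<omega>))"
    using integral_quad(1)[OF Q(1) a] integral_scalar_prod_mult(1)[OF QL a e] integral_quad(1)[OF LQL e] by simp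
  also have "expectation (\<lambda>\<omega>. ?a \<omega> \<bullet> ((Q * L) *\<^sub>v ?e \<omega>)) = 0"
    by (rule integral_scalar_prod_mult_eq_0[OF QL a e])
      (intro estimation_error_orthogonal[OF pol t'(2) x] measurable_borel_vecD(2)[OF am] square_integrable_vecD(4)[OF a])
  also have "expectation (\<lambda>\<omega>. quad (L\<^sup>T * Q * L) (?e \<omega>)) = tr (L\<^sup>T * Q * L * err_cov G S u t)"
  proof (rule integral_quad_tr[OF LQL e])
    show "err_cov G S u t \<in> carrier_mat n n" by (simp add: err_cov_def)
    fix i j assume ij: "i < n" "j < n"
    have "dim_vec (?k \<omega>) = n" for \<omega> by (simp add: kalman_est_eq)
    then show "expectation (\<lambda>\<omega>. ?e \<omega> $ i * ?e \<omega> $ j) = err_cov G S u t $$ (j, i)"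
      using ij by (simp add: err_cov_def mult.commute)
  qed
  finally show ?thesis by simp
qed

end

end

section \<open>Independence of the noise, finite costs and Kalman controllers\<close>

lemma events_of_Pow: "events_of M X L \<subseteq> Pow (space M)"
  using sets.space_closed[of "vimage_algebra (space M) X L"] by (simp add: events_of_def)

context lqg_system
begin

lemma source_events_Pow: "source_events G k \<subseteq> Pow (space M)"
  by (cases k) (simp_all only: source_events.simps events_of_Pow)

definition source_algebra :: "source set \<Rightarrow> 'w measure" where
  "source_algebra I = sigma (space M) (\<Union>k\<in>I. source_events G k)"

lemma space_source_algebra [simp]: "space (source_algebra I) = space M"
  unfolding source_algebra_def by (rule space_measure_of) (use source_events_Pow in blast)

lemma sets_source_algebra: "sets (source_algebra I) = sigma_sets (space M) (\<Union>k\<in>I. source_events G k)"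
  unfolding source_algebra_def by (rule sets_measure_of) (use source_events_Pow in blast)

lemma measurable_source_algebra:
  assumes "k \<in> I" "source_events G k = events_of M X L" "X \<in> space M \<rightarrow> space L"
  shows "X \<in> measurable (source_algebra I) L"
proof (rule measurableI)
  fix A assume "A \<in> sets L"
  then have "X -` A \<inter> space M \<in> source_events G k"
    unfolding assms(2) events_of_def by (rule in_vimage_algebra)
  then show "X -` A \<inter> space (source_algebra I) \<in> sets (source_algebra I)"
    using assms(1) by (auto simp: sets_source_algebra)
qed (use assms(3) in auto)

lemma meas_v_measurable_source_algebra:
  assumes "Meas \<in> I" "i \<in> sensors G" "s \<in> {1..T}"
  shows "meas_v G i s \<in> measurable (source_algebra I) (borel_vec (dimy G i s))"
proof -
  let ?X = "\<lambda>\<omega>. \<lambda>t\<in>{1..T}. \<lambda>i\<in>sensors G. meas_v G i t \<omega>"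
  have "?X \<in> space M \<rightarrow> space (obs_space G (sensors G) T)"
    using measurable_borel_vecD(1)[OF sensor_carrier(2)]
    by (auto simp: obs_space_def space_PiM)
  then have "?X \<in> measurable (source_algebra I) (obs_space G (sensors G) T)"
    by (intro measurable_source_algebra[OF assms(1)]) simp_all
  note h = this[unfolded obs_space_def]
  from measurable_compose[OF measurable_compose[OF h measurable_component_singleton[OF assms(3)]]
      measurable_component_singleton[OF assms(2)]]
  show ?thesis using assms(2,3) by simp
qed

text \<open>Grouping independent sources into disjoint blocks preserves independence; noises
  \<open>Proc s\<close> with \<open>s > t\<close> are dropped. The measurement noises of all times
  count as past, since they form one source.\<close>

lemma indep_past_proc:
  assumes "t \<in> {1..T}"
  shows "indep_set (sets (source_algebra ({Init, Meas} \<union> Proc ` {1..<t}))) (sets (source_algebra {Proc t}))"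
proof -
  \<comment> \<open>\<open>indep_set\<close> is \<open>indep_sets\<close> over \<open>bool\<close>,
    so the two blocks are indexed by truth values.\<close>
  let ?I = "case_bool ({Init, Meas} \<union> Proc ` {1..<t}) {Proc t}"
  have "indep_sets (source_events G) ({Init, Meas} \<union> Proc ` {1..T})"
    using lqg by (simp add: lqg_setting_def)
  then have *: "indep_sets (source_events G) (\<Union>b\<in>UNIV. ?I b)"
    by (rule indep_sets_mono_index[rotated]) (use assms in \<open>auto split: bool.splits\<close>)
  have "indep_sets (\<lambda>b. sigma_sets (space M) (\<Union>k\<in>?I b. source_events G k)) UNIV"
  proof (rule indep_sets_collect_sigma[OF *])
    show "Int_stable (source_events G k)" for k
      by (cases k) (auto simp: Int_stable_def events_of_def)
    show "disjoint_family ?I"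
      by (auto simp: disjoint_family_on_def split: bool.splits)
  qed
  also have "(\<lambda>b. sigma_sets (space M) (\<Union>k\<in>?I b. source_events G k)) =
      case_bool (sets (source_algebra ({Init, Meas} \<union> Proc ` {1..<t}))) (sets (source_algebra {Proc t}))"
    by (auto simp: fun_eq_iff sets_source_algebra split: bool.splits)
  finally show ?thesis by (simp only: indep_set_def)
qed

text \<open>Causality: state and control at \<open>t\<close> are measurable for the past block,
  hence independent of the centred noise \<open>proc_w G t\<close>.\<close>

lemma proc_uncorrelated_past:
  assumes S: "S \<subseteq> sensors G" and u: "square_integrable_policy S u" and t: "t \<in> {1..T}" and ij: "i < n" "j < n"
  shows "expectation (\<lambda>\<omega>. (sys_A G t *\<^sub>v state G S u t \<omega> + sys_B G t *\<^sub>v control G S u t \<omega>) $ i * proc_w G t \<omega> $ j) = 0"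
proof -
  let ?P = "{Init, Meas} \<union> Proc ` {1..<t}"
  let ?F = "source_algebra ?P"
  let ?z = "\<lambda>\<omega>. sys_A G t *\<^sub>v state G S u t \<omega> + sys_B G t *\<^sub>v control G S u t \<omega>"
  note pol = square_integrable_policyD(1)[OF u]
  have init: "init_x G \<in> measurable ?F (borel_vec n)"
    by (rule measurable_source_algebra[of Init]) (use measurable_borel_vecD(1)[OF init_measurable] in auto)
  have proc: "proc_w G s \<in> measurable ?F (borel_vec n)" if "s \<in> {1..<t}" for s
    by (rule measurable_source_algebra[of "Proc s"])
      (use that t measurable_borel_vecD(1)[OF proc_measurable[of s]] in auto)
  have v: "meas_v G i s \<in> measurable ?F (borel_vec (dimy G i s))" if "s \<in> {1..T}" "i \<in> S" for s i
    using that S by (intro meas_v_measurable_source_algebra) auto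
  have x: "state G S u t \<in> measurable ?F (borel_vec n)"
    using t by (intro state_measurable[OF pol S init v proc]) auto
  have "history G S u t \<in> measurable ?F (obs_space G S t)"
    using t by (intro history_measurable reading_measurable[OF pol S init v proc]) auto
  then have c: "control G S u t \<in> measurable ?F (borel_vec (dimu G t))"
    by (rule control_measurable[OF pol t])
  have z: "?z \<in> measurable ?F (borel_vec n)"
    by (intro measurable_borel_vec_add measurable_borel_vec_mult[OF system_carrier(1)[OF t] x]
        measurable_borel_vec_mult[OF system_carrier(2)[OF t] c])
  have w: "proc_w G t \<in> measurable (source_algebra {Proc t}) (borel_vec n)"
    by (rule measurable_source_algebra[of "Proc t"]) (use measurable_borel_vecD(1)[OF proc_measurable[OF t]] in auto)
  have sz: "square_integrable_vec M n ?z"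
    using t by (intro square_integrable_vec_add square_integrable_vec_mult[OF system_carrier(1)[OF t]]
        square_integrable_vec_mult[OF system_carrier(2)[OF t]] square_integrable_policyD[OF u]) auto
  have "expectation (\<lambda>\<omega>. ?z \<omega> $ i * proc_w G t \<omega> $ j) = expectation (\<lambda>\<omega>. ?z \<omega> $ i) * expectation (\<lambda>\<omega>. proc_w G t \<omega> $ j)"
  proof (rule expectation_indep_subalgebras[OF indep_past_proc[OF t]])
    show "integrable M (\<lambda>\<omega>. ?z \<omega> $ i)"
      by (rule square_integrable_imp_integrable[OF square_integrable_vecD(3,4)[OF sz ij(1)]])
    show "integrable M (\<lambda>\<omega>. proc_w G t \<omega> $ j)"
      by (rule square_integrable_imp_integrable[OF square_integrable_vecD(3,4)[OF proc_square_integrable[OF t] ij(2)]])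
  qed (use measurable_borel_vecD(2)[OF z ij(1)] measurable_borel_vecD(2)[OF w ij(2)] in simp_all)
  also have "expectation (\<lambda>\<omega>. proc_w G t \<omega> $ j) = 0"
    using gaussian_vec_expectation[OF system_carrier(5)[OF t] ij(2)] ij(2) by simp
  finally show ?thesis by simp
qed

text \<open>The state term is nonnegative, so the cost bounds the mean of the control term;
  definiteness of \<open>wt_R G t\<close> bounds each squared coordinate by a multiple of that
  term.\<close>

lemma square_integrable_policy_if_finite_cost:
  assumes S: "S \<subseteq> sensors G" and u: "is_policy G S u" and fin: "lqg_cost G S u < \<infinity>"
  shows "square_integrable_policy S u"
  unfolding square_integrable_policy_def
proof (intro conjI ballI u)
  fix t assume t: "t \<in> {1..T}"
  let ?c = "control G S u t" and ?x = "state G S u (t + 1)" and ?R = "wt_R G t" and ?Q = "wt_Q G t"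
  have c: "?c \<in> measurable M (borel_vec (dimu G t))" by (rule control_measurable_M[OF S u t])
  have x: "?x \<in> measurable M (borel_vec n)" using t by (intro state_measurable_M[OF S u]) auto
  have R: "0 \<le> quad ?R (?c \<omega>)" and Q: "0 \<le> quad ?Q (?x \<omega>)" if "\<omega> \<in> space M" for \<omega>
    using pos_semidef_nonneg[OF pos_def_imp_pos_semidef[OF system_carrier(4)[OF t]] measurable_borel_vecD(1)[OF c that]]
      pos_semidef_nonneg[OF system_carrier(3)[OF t] measurable_borel_vecD(1)[OF x that]] by auto
  have "(\<integral>\<^sup>+ \<omega>. ennreal (quad ?R (?c \<omega>)) \<partial>M) \<le> (\<integral>\<^sup>+ \<omega>. ennreal (quad ?Q (?x \<omega>) + quad ?R (?c \<omega>)) \<partial>M)"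
    by (intro nn_integral_mono ennreal_leI) (use Q in auto)
  also have "\<dots> \<le> lqg_cost G S u"
    unfolding lqg_cost_def by (rule member_le_sum[OF t]) auto
  also note fin
  finally have "(\<integral>\<^sup>+ \<omega>. ennreal (quad ?R (?c \<omega>)) \<partial>M) < \<infinity>" .
  moreover have "(\<lambda>\<omega>. quad ?R (?c \<omega>)) \<in> borel_measurable M"
    by (rule borel_measurable_quad[OF pos_def_carrier(1)[OF system_carrier(4)[OF t]] c])
  ultimately have int: "integrable M (\<lambda>\<omega>. quad ?R (?c \<omega>))"
    using R by (intro integrableI_nonneg) auto
  show "square_integrable_vec M (dimu G t) ?c"
    unfolding square_integrable_vec_def
  proof (intro conjI allI impI c)
    fix j assume j: "j < dimu G t"
    obtain b where b: "b \<ge> 0" "\<And>z. z \<in> carrier_vec (dimu G t) \<Longrightarrow> (z $ j)\<^sup>2 \<le> b * quad ?R z"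
      using pos_def_coordinate_bound[OF system_carrier(4)[OF t] j] by auto
    show "integrable M (\<lambda>\<omega>. (?c \<omega> $ j)\<^sup>2)"
    proof (rule Bochner_Integration.integrable_bound)
      show "integrable M (\<lambda>\<omega>. b * quad ?R (?c \<omega>))" using int by simp
      show "AE \<omega> in M. norm ((?c \<omega> $ j)\<^sup>2) \<le> norm (b * quad ?R (?c \<omega>))"
        using b(2)[OF measurable_borel_vecD(1)[OF c]] by (intro AE_I2) force
    qed (use measurable_borel_vecD(2)[OF c j] in simp)
  qed
qed

end

section \<open>Causality and the construction of the Kalman controller\<close>

lemma state_cong:
  assumes "\<And>s. s < t \<Longrightarrow> u s = u' s"
  shows "state G S u t \<omega> = state G S u' t \<omega>"
  using assms
proof (induction t rule: less_induct)
  case (less t)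
  then have IH: "s < t \<Longrightarrow> state G S u s \<omega> = state G S u' s \<omega>" for s by simp
  have "(\<lambda>s\<in>{1..t - 1}. \<lambda>i\<in>S. sens_C G i s *\<^sub>v state G S u s \<omega> + meas_v G i s \<omega>) =
      (\<lambda>s\<in>{1..t - 1}. \<lambda>i\<in>S. sens_C G i s *\<^sub>v state G S u' s \<omega> + meas_v G i s \<omega>)" if "1 < t"
    using IH that by (intro restrict_ext) auto
  then show ?case
    using IH less.prems by (subst (1 2) state.simps) auto
qed

lemma history_cong:
  assumes "\<And>s. s < t \<Longrightarrow> u s = u' s"
  shows "history G S u t = history G S u' t"
proof
  fix \<omega>
  have "state G S u s \<omega> = state G S u' s \<omega>" if "s \<le> t" for s
    using that assms by (intro state_cong) auto
  then show "history G S u t \<omega> = history G S u' t \<omega>"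
    unfolding history_def reading_def by (intro restrict_ext) auto
qed

text \<open>The strict inequality is what breaks the circularity of the Kalman controller: the
  control at \<open>t\<close> may be chosen after the estimate at \<open>t\<close> is known.\<close>

lemma kalman_est_cong:
  assumes "\<And>s. s < t \<Longrightarrow> u s = u' s"
  shows "kalman_est G S u t = kalman_est G S u' t"
proof -
  have "state G S u t = state G S u' t" by (rule ext, rule state_cong) (rule assms)
  moreover have "history G S u t = history G S u' t" by (rule history_cong) (rule assms)
  ultimately show ?thesis by (simp add: kalman_est_def[abs_def])
qed

context lqg_system
begin

text \<open>The policy is corrected one time at a time, which leaves the estimates up to that time
  unchanged. Equality holds everywhere on the space and not just almost surely, because the
  factorization reproduces the very version of the conditional expectation that
  \<open>kalman_est\<close> uses.\<close>

lemma kalman_controller_exists: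
  assumes S: "S \<subseteq> sensors G" and K: "\<And>t. t \<in> {1..T} \<Longrightarrow> K t \<in> carrier_mat (dimu G t) n"
  shows "\<exists>u. kalman_controller G K S u"
proof -
  have "\<exists>u. is_policy G S u \<and> (\<forall>t\<in>{1..k}. \<forall>\<omega>\<in>space M. control G S u t \<omega> = K t *\<^sub>v kalman_est G S u t \<omega>)"
    if "k \<le> T" for k
    using that
  proof (induction k)
    case 0
    show ?case by (intro exI[of _ "\<lambda>t h. 0\<^sub>v (dimu G t)"]) (auto simp: is_policy_def)
  next
    case (Suc k)
    then obtain u where u: "is_policy G S u"
      and uk: "\<And>t \<omega>. t \<in> {1..k} \<Longrightarrow> \<omega> \<in> space M \<Longrightarrow> control G S u t \<omega> = K t *\<^sub>v kalman_est G S u t \<omega>"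
      by auto
    let ?t = "Suc k"
    have t: "?t \<in> {1..T}" "?t \<le> T" using Suc.prems by auto
    \<comment> \<open>A policy must be a function of the history, whereas the estimate is a function
      of \<open>\<omega>\<close>; the factorization through the history converts it, coordinate by
      coordinate.\<close>
    have "\<exists>g \<in> borel_measurable (obs_space G S ?t). \<forall>\<omega>\<in>space M. kalman_est G S u ?t \<omega> $ j = g (history G S u ?t \<omega>)"
      if "j < n" for j
      by (rule doob_dynkin)
        (use measurable_borel_vecD(2)[OF kalman_est_measurable that] measurable_space[OF history_measurable_M[OF S u t(2)]]
         in \<open>auto simp: obs_algebra_def\<close>)
    then obtain g where g: "\<And>j. j < n \<Longrightarrow> g j \<in> borel_measurable (obs_space G S ?t)"
      and gk: "\<And>j \<omega>. j < n \<Longrightarrow> \<omega> \<in> space M \<Longrightarrow> kalman_est G S u ?t \<omega> $ j = g j (history G S u ?t \<omega>)"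
      by metis
    let ?g = "\<lambda>h. vec n (\<lambda>j. g j h)"
    have gm: "?g \<in> measurable (obs_space G S ?t) (borel_vec n)"
      using g by (auto simp: measurable_borel_vec_iff)
    define u' where "u' = u(?t := \<lambda>h. K ?t *\<^sub>v ?g h)"
    have u': "is_policy G S u'"
      using u measurable_borel_vec_mult[OF K[OF t(1)] gm] by (auto simp: is_policy_def u'_def)
    \<comment> \<open>A change at time \<open>?t\<close> affects neither histories nor estimates up
      to and including \<open>?t\<close>.\<close>
    have same: "history G S u' t = history G S u t" "kalman_est G S u' t = kalman_est G S u t" if "t \<le> ?t" for t
      using that by (auto intro!: history_cong kalman_est_cong simp: u'_def)
    have "control G S u' t \<omega> = K t *\<^sub>v kalman_est G S u' t \<omega>" if "t \<in> {1..?t}" "\<omega> \<in> space M" for t \<omega>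
    proof (cases "t = ?t")
      case True
      have "?g (history G S u ?t \<omega>) = kalman_est G S u ?t \<omega>"
        using gk that by (intro eq_vecI) (auto simp: kalman_est_eq)
      then show ?thesis using same[of ?t] by (simp add: True control_def u'_def)
    next
      case False
      then show ?thesis using that uk[of t \<omega>] same[of t] by (auto simp: control_def u'_def)
    qed
    with u' show ?case by blast
  qed
  from this[of T] show ?thesis unfolding kalman_controller_def by auto
qed

text \<open>State, estimate and control advance together: earlier controls bound the state, Jensen
  bounds the estimate, and the control is almost surely \<open>K t\<close> applied to it.\<close>

lemma square_integrable_policy_if_kalman_controller:
  assumes S: "S \<subseteq> sensors G" and K: "\<And>t. t \<in> {1..T} \<Longrightarrow> K t \<in> carrier_mat (dimu G t) n"
    and u: "kalman_controller G K S u"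
  shows "square_integrable_policy S u"
proof -
  have pol: "is_policy G S u" using u by (simp add: kalman_controller_def)
  have "t \<in> {1..T} \<Longrightarrow> square_integrable_vec M (dimu G t) (control G S u t)" for t
  proof (induction t rule: less_induct)
    case (less t)
    then have "square_integrable_vec M n (state G S u t)"
      by (intro state_square_integrable) auto
    then have "square_integrable_vec M n (kalman_est G S u t)"
      using less.prems by (intro kalman_est_square_integrable[OF S pol]) auto
    from square_integrable_vec_mult[OF K[OF less.prems] this] show ?case
      by (rule square_integrable_vec_cong_AE)
        (use u less.prems control_measurable_M[OF S pol less.prems] in \<open>auto simp: kalman_controller_def\<close>)
  qed
  with pol show ?thesis by (simp add: square_integrable_policy_def)
qed

end

section \<open>Separation\<close>

lemma sum_telescope_real:
  fixes a :: "nat \<Rightarrow> real"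
  shows "(\<Sum>t=1..k. a t - a (t + 1)) = a 1 - a (k + 1)"
  by (induction k) auto

locale lqg_riccati = lqg_system G for G :: "('w, 'i) lqg" +
  fixes St Nt Mt K \<Theta> :: "nat \<Rightarrow> real mat"
  assumes riccati: "riccati_solution G St Nt Mt K \<Theta>"
begin

section \<open>Definiteness of the Riccati matrices\<close>

lemma riccati_unfold:
  shows "Nt (T + 1) = 0\<^sub>m n n"
    and "t \<in> {1..T} \<Longrightarrow> St t = wt_Q G t + Nt (t + 1)"
    and "t \<in> {1..T} \<Longrightarrow> invertible_mat (St t)"
    and "t \<in> {1..T} \<Longrightarrow> Nt t = (sys_A G t)\<^sup>T
                 * minv (minv (St t) + sys_B G t * minv (wt_R G t) * (sys_B G t)\<^sup>T)
                 * sys_A G t"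
    and "t \<in> {1..T} \<Longrightarrow> Mt t = (sys_B G t)\<^sup>T * St t * sys_B G t + wt_R G t"
    and "t \<in> {1..T} \<Longrightarrow> K t = - (minv (Mt t) * (sys_B G t)\<^sup>T * St t * sys_A G t)"
    and "t \<in> {1..T} \<Longrightarrow> \<Theta> t = (K t)\<^sup>T * Mt t * K t"
  using riccati unfolding riccati_solution_def by blast+

lemma St_pos_def_if:
  assumes "t \<in> {1..T}" "pos_semidef n (Nt (t + 1))"
  shows "pos_def n (St t)"
  using pos_semidef_invertible_imp_pos_def[OF pos_semidef_add[OF system_carrier(3)[OF assms(1)] assms(2)]]
    riccati_unfold(2,3)[OF assms(1)] by simp

text \<open>Backward induction: semidefiniteness of \<open>Nt (t + 1)\<close> passes to
  \<open>St t\<close>, the invertibility in \<open>riccati_solution\<close> makes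
  \<open>St t\<close> definite, and \<open>riccati_step\<close> returns \<open>Nt t\<close>.\<close>

lemma Nt_pos_semidef:
  assumes "1 \<le> t" "t \<le> T + 1"
  shows "pos_semidef n (Nt t)"
  using assms(2,1)
proof (induction t rule: inc_induct)
  case base
  then show ?case by (simp add: riccati_unfold(1)[simplified] pos_semidef_zero)
next
  case (step t)
  then have t: "t \<in> {1..T}" by simp
  have "pos_def n (St t)" by (rule St_pos_def_if[OF t]) (use step in simp)
  from riccati_step(1)[OF this system_carrier(4,1,2)[OF t] refl refl refl]
  show ?case using riccati_unfold(4)[OF t] by simp
qed

lemma St_pos_def: "t \<in> {1..T} \<Longrightarrow> pos_def n (St t)"
  by (rule St_pos_def_if) (auto intro: Nt_pos_semidef)

lemma Mt_pos_def: "t \<in> {1..T} \<Longrightarrow> pos_def (dimu G t) (Mt t)"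
  by (rule riccati_step(2)[OF St_pos_def system_carrier(4,1,2) refl riccati_unfold(5,6)])

lemma K_carrier: "t \<in> {1..T} \<Longrightarrow> K t \<in> carrier_mat (dimu G t) n"
  by (rule riccati_step(3)[OF St_pos_def system_carrier(4,1,2) refl riccati_unfold(5,6)])

lemma completion_of_squares:
  assumes t: "t \<in> {1..T}" and "x \<in> carrier_vec n" "c \<in> carrier_vec (dimu G t)"
  shows "quad (St t) (sys_A G t *\<^sub>v x + sys_B G t *\<^sub>v c) + quad (wt_R G t) c =
    quad (Nt t) x + quad (Mt t) (c - K t *\<^sub>v x)"
  using riccati_step(4)[OF St_pos_def[OF t] system_carrier(4,1,2)[OF t] refl riccati_unfold(5,6)[OF t] assms(2,3)]
  unfolding riccati_unfold(4)[OF t, symmetric] .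

text \<open>The excess cost at time \<open>t\<close> over the Kalman controller; for fixed sensors
  it is the only part of a finite cost that varies with the policy.\<close>

definition control_gap :: "'i set \<Rightarrow> 'i policy \<Rightarrow> nat \<Rightarrow> real" where
  "control_gap S u t = expectation (\<lambda>\<omega>. quad (Mt t) (control G S u t \<omega> - K t *\<^sub>v kalman_est G S u t \<omega>))"

text \<open>The part of the cost shared by all sensor sets and policies. The first term stays an
  expectation, so that it covers an initial state with nonzero mean.\<close>

definition base_cost :: real where
  "base_cost = expectation (\<lambda>\<omega>. quad (Nt 1) (init_x G \<omega>)) + (\<Sum>t=1..T. tr (proc_cov G t * St t))"

context
  fixes S :: "'i set"
  assumes S: "S \<subseteq> sensors G"
begin

lemma expected_stage_cost:
  assumes u: "square_integrable_policy S u" and t: "t \<in> {1..T}"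
  shows "integrable M (\<lambda>\<omega>. quad (wt_Q G t) (state G S u (t + 1) \<omega>) + quad (wt_R G t) (control G S u t \<omega>))"
    and "expectation (\<lambda>\<omega>. quad (wt_Q G t) (state G S u (t + 1) \<omega>) + quad (wt_R G t) (control G S u t \<omega>)) =
      expectation (\<lambda>\<omega>. quad (Nt t) (state G S u t \<omega>)) - expectation (\<lambda>\<omega>. quad (Nt (t + 1)) (state G S u (t + 1) \<omega>))
      + tr (proc_cov G t * St t) + tr (\<Theta> t * err_cov G S u t) + control_gap S u t"
proof -
  let ?A = "sys_A G t" and ?B = "sys_B G t" and ?w = "proc_w G t" and ?x = "state G S u t" and ?c = "control G S u t"
    and ?x' = "state G S u (t + 1)"
  let ?z = "\<lambda>\<omega>. ?A *\<^sub>v ?x \<omega> + ?B *\<^sub>v ?c \<omega>"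
  note A = system_carrier(1)[OF t] and B = system_carrier(2)[OF t]
  have x: "square_integrable_vec M n ?x" and x': "square_integrable_vec M n ?x'"
    using t by (auto intro!: square_integrable_policyD(3)[OF u] simp del: Suc_eq_plus1)
  note c = square_integrable_policyD(2)[OF u t] and w = proc_square_integrable[OF t]
  have z: "square_integrable_vec M n ?z"
    by (intro square_integrable_vec_add square_integrable_vec_mult[OF A] square_integrable_vec_mult[OF B] x c)
  have d: "square_integrable_vec M (dimu G t) (\<lambda>\<omega>. ?c \<omega> - K t *\<^sub>v ?x \<omega>)"
    by (rule square_integrable_vec_diff[OF c square_integrable_vec_mult[OF K_carrier[OF t] x]])
  note Q = pos_semidef_carrier[OF system_carrier(3)[OF t]] and R = pos_def_carrier[OF system_carrier(4)[OF t]]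
    and SS = pos_def_carrier[OF St_pos_def[OF t]] and MM = pos_def_carrier[OF Mt_pos_def[OF t]]
  have N: "Nt t \<in> carrier_mat n n" and N': "Nt (t + 1) \<in> carrier_mat n n"
    using t by (auto intro!: pos_semidef_carrier Nt_pos_semidef)
  show int: "integrable M (\<lambda>\<omega>. quad (wt_Q G t) (?x' \<omega>) + quad (wt_R G t) (?c \<omega>))"
    by (rule Bochner_Integration.integrable_add[OF integral_quad(1)[OF Q(1) x'] integral_quad(1)[OF R(1) c]])
  have eq: "quad (wt_Q G t) (?x' \<omega>) + quad (wt_R G t) (?c \<omega>) =
      quad (Nt t) (?x \<omega>) - quad (Nt (t + 1)) (?x' \<omega>) + quad (St t) (?w \<omega>)
      + quad (Mt t) (?c \<omega> - K t *\<^sub>v ?x \<omega>) + 2 * (?z \<omega> \<bullet> (St t *\<^sub>v ?w \<omega>))"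
    if om: "\<omega> \<in> space M" for \<omega>
  proof -
    note car = square_integrable_vecD(2)[OF x om] square_integrable_vecD(2)[OF c om]
      square_integrable_vecD(2)[OF z om] square_integrable_vecD(2)[OF w om] square_integrable_vecD(2)[OF x' om]
    have x'_eq: "?x' \<omega> = ?z \<omega> + ?w \<omega>" using t by (intro state_Suc) simp
    \<comment> \<open>The form \<open>Nt (t + 1)\<close> at the next state completes
      \<open>wt_Q G t\<close> to \<open>St t\<close>; the next state is then split into its
      predicted part \<open>?z\<close> and the noise.\<close>
    have "quad (wt_Q G t) (?x' \<omega>) + quad (Nt (t + 1)) (?x' \<omega>) = quad (St t) (?x' \<omega>)"
      unfolding riccati_unfold(2)[OF t] by (rule quad_add_mat[OF Q(1) N' car(5), symmetric])
    also have "quad (St t) (?x' \<omega>) = quad (St t) (?z \<omega>) + 2 * (?z \<omega> \<bullet> (St t *\<^sub>v ?w \<omega>)) + quad (St t) (?w \<omega>)"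
      unfolding x'_eq by (rule quad_add[OF SS car(3,4)])
    finally show ?thesis using completion_of_squares[OF t car(1,2)] by simp
  qed
  have "expectation (\<lambda>\<omega>. quad (wt_Q G t) (?x' \<omega>) + quad (wt_R G t) (?c \<omega>)) =
    expectation (\<lambda>\<omega>. quad (Nt t) (?x \<omega>) - quad (Nt (t + 1)) (?x' \<omega>) + quad (St t) (?w \<omega>)
      + quad (Mt t) (?c \<omega> - K t *\<^sub>v ?x \<omega>) + 2 * (?z \<omega> \<bullet> (St t *\<^sub>v ?w \<omega>)))"
    by (intro Bochner_Integration.integral_cong refl eq)
  also have "\<dots> = expectation (\<lambda>\<omega>. quad (Nt t) (?x \<omega>)) - expectation (\<lambda>\<omega>. quad (Nt (t + 1)) (?x' \<omega>))
      + expectation (\<lambda>\<omega>. quad (St t) (?w \<omega>)) + expectation (\<lambda>\<omega>. quad (Mt t) (?c \<omega> - K t *\<^sub>v ?x \<omega>))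
      + 2 * expectation (\<lambda>\<omega>. ?z \<omega> \<bullet> (St t *\<^sub>v ?w \<omega>))"
    using integral_quad(1)[OF N x] integral_quad(1)[OF N' x'] integral_quad(1)[OF SS(1) w]
      integral_quad(1)[OF MM(1) d] integral_scalar_prod_mult(1)[OF SS(1) z w] by simp
  also have "expectation (\<lambda>\<omega>. ?z \<omega> \<bullet> (St t *\<^sub>v ?w \<omega>)) = 0"
    by (rule integral_scalar_prod_mult_eq_0[OF SS(1) z w]) (rule proc_uncorrelated_past[OF S u t])
  also have "expectation (\<lambda>\<omega>. quad (St t) (?w \<omega>)) = tr (St t * proc_cov G t)"
  proof (rule integral_quad_tr[OF SS(1) w])
    show "proc_cov G t \<in> carrier_mat n n"
      using system_carrier(5)[OF t] by (simp add: gaussian_vec_def pos_semidef_def)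
    show "expectation (\<lambda>\<omega>. ?w \<omega> $ i * ?w \<omega> $ j) = proc_cov G t $$ (j, i)" if "i < n" "j < n" for i j
      using gaussian_vec_second_moment[OF system_carrier(5)[OF t] that(2,1)] by (simp add: mult.commute)
  qed
  also have "tr (St t * proc_cov G t) = tr (proc_cov G t * St t)"
    by (rule tr_mult_comm[OF SS(1)]) (use system_carrier(5)[OF t] in \<open>simp add: gaussian_vec_def pos_semidef_def\<close>)
  also have "expectation (\<lambda>\<omega>. quad (Mt t) (?c \<omega> - K t *\<^sub>v ?x \<omega>)) = control_gap S u t + tr (\<Theta> t * err_cov G S u t)"
    unfolding control_gap_def riccati_unfold(7)[OF t]
    by (rule expectation_quad_separation[OF S u t MM K_carrier[OF t]])
  finally show "expectation (\<lambda>\<omega>. quad (wt_Q G t) (?x' \<omega>) + quad (wt_R G t) (?c \<omega>)) =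
      expectation (\<lambda>\<omega>. quad (Nt t) (?x \<omega>)) - expectation (\<lambda>\<omega>. quad (Nt (t + 1)) (?x' \<omega>))
      + tr (proc_cov G t * St t) + tr (\<Theta> t * err_cov G S u t) + control_gap S u t"
    by simp
qed

text \<open>The stage identities telescope. The second claim is recorded because
  \<open>ennreal\<close> maps every negative real to \<open>0\<close>, so a real value can be
  recovered from the cost only when it is nonnegative.\<close>

lemma lqg_cost_eq:
  assumes u: "square_integrable_policy S u"
  shows "lqg_cost G S u = ennreal (base_cost + (\<Sum>t=1..T. tr (\<Theta> t * err_cov G S u t)) + (\<Sum>t=1..T. control_gap S u t))"
    and "0 \<le> base_cost + (\<Sum>t=1..T. tr (\<Theta> t * err_cov G S u t)) + (\<Sum>t=1..T. control_gap S u t)"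
proof -
  let ?f = "\<lambda>t \<omega>. quad (wt_Q G t) (state G S u (t + 1) \<omega>) + quad (wt_R G t) (control G S u t \<omega>)"
  let ?N = "\<lambda>t. expectation (\<lambda>\<omega>. quad (Nt t) (state G S u t \<omega>))"
  have nn: "0 \<le> ?f t \<omega>" if t: "t \<in> {1..T}" and om: "\<omega> \<in> space M" for t \<omega>
  proof -
    have "square_integrable_vec M n (state G S u (t + 1))"
      using t by (intro square_integrable_policyD(3)[OF u]) auto
    then show ?thesis
      using pos_semidef_nonneg[OF system_carrier(3)[OF t] square_integrable_vecD(2)]
        pos_semidef_nonneg[OF pos_def_imp_pos_semidef[OF system_carrier(4)[OF t]]
          square_integrable_vecD(2)[OF square_integrable_policyD(2)[OF u t] om]] om
      by (intro add_nonneg_nonneg) auto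
  qed
  have nnE: "0 \<le> expectation (?f t)" if "t \<in> {1..T}" for t
    using nn[OF that] by (intro Bochner_Integration.integral_nonneg) auto
  have "lqg_cost G S u = (\<Sum>t=1..T. ennreal (expectation (?f t)))"
    unfolding lqg_cost_def
    by (intro sum.cong refl nn_integral_eq_integral expected_stage_cost(1)[OF u]) (use nn in auto)
  also have "\<dots> = ennreal (\<Sum>t=1..T. expectation (?f t))"
    using nnE by (rule sum_ennreal)
  finally have cost: "lqg_cost G S u = ennreal (\<Sum>t=1..T. expectation (?f t))" .
  have "(\<Sum>t=1..T. expectation (?f t)) = (\<Sum>t=1..T. (?N t - ?N (t + 1)) + tr (proc_cov G t * St t)
      + tr (\<Theta> t * err_cov G S u t) + control_gap S u t)"
    by (intro sum.cong refl expected_stage_cost(2)[OF u])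
  also have "\<dots> = (\<Sum>t=1..T. ?N t - ?N (t + 1)) + (\<Sum>t=1..T. tr (proc_cov G t * St t))
      + (\<Sum>t=1..T. tr (\<Theta> t * err_cov G S u t)) + (\<Sum>t=1..T. control_gap S u t)"
    by (simp only: sum.distrib)
  also have "(\<Sum>t=1..T. ?N t - ?N (t + 1)) = ?N 1 - ?N (T + 1)"
    by (rule sum_telescope_real)
  \<comment> \<open>The boundary condition of the recursion closes the telescope.\<close>
  also have "?N (T + 1) = 0"
  proof -
    have "square_integrable_vec M n (state G S u (T + 1))"
      by (rule square_integrable_policyD(3)[OF u]) auto
    then have "?N (T + 1) = expectation (\<lambda>_. 0)"
      by (intro Bochner_Integration.integral_cong)
        (auto simp: riccati_unfold(1)[simplified] quad_zero dest: square_integrable_vecD(2))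
    then show ?thesis by simp
  qed
  also have "state G S u 1 = init_x G" by (rule ext) (rule state_1)
  finally have E: "(\<Sum>t=1..T. expectation (?f t)) =
      base_cost + (\<Sum>t=1..T. tr (\<Theta> t * err_cov G S u t)) + (\<Sum>t=1..T. control_gap S u t)"
    by (simp add: base_cost_def)
  show "lqg_cost G S u = ennreal (base_cost + (\<Sum>t=1..T. tr (\<Theta> t * err_cov G S u t)) + (\<Sum>t=1..T. control_gap S u t))"
    using cost E by simp
  show "0 \<le> base_cost + (\<Sum>t=1..T. tr (\<Theta> t * err_cov G S u t)) + (\<Sum>t=1..T. control_gap S u t)"
    unfolding E[symmetric] using nnE by (rule sum_nonneg)
qed

text \<open>A nonnegative integrand with mean zero vanishes almost surely, and the definite form
  \<open>Mt t\<close> vanishes only at the zero vector.\<close>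

lemma control_gap_eq_0_iff:
  assumes u: "square_integrable_policy S u" and t: "t \<in> {1..T}"
  shows "0 \<le> control_gap S u t"
    and "control_gap S u t = 0 \<longleftrightarrow> (AE \<omega> in M. control G S u t \<omega> = K t *\<^sub>v kalman_est G S u t \<omega>)"
proof -
  have t': "1 \<le> t" "t \<le> T" "t \<le> T + 1" using t by auto
  let ?d = "\<lambda>\<omega>. control G S u t \<omega> - K t *\<^sub>v kalman_est G S u t \<omega>"
  note c = square_integrable_policyD(2)[OF u t]
  have k: "square_integrable_vec M (dimu G t) (\<lambda>\<omega>. K t *\<^sub>v kalman_est G S u t \<omega>)"
    by (intro square_integrable_vec_mult[OF K_carrier[OF t]] kalman_est_square_integrable[OF S]
        square_integrable_policyD[OF u] t')
  have d: "square_integrable_vec M (dimu G t) ?d"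
    by (rule square_integrable_vec_diff[OF c k])
  note MM = Mt_pos_def[OF t]
  have nn: "0 \<le> quad (Mt t) (?d \<omega>)" if "\<omega> \<in> space M" for \<omega>
    by (rule pos_semidef_nonneg[OF pos_def_imp_pos_semidef[OF MM] square_integrable_vecD(2)[OF d that]])
  then show "0 \<le> control_gap S u t"
    unfolding control_gap_def by (intro Bochner_Integration.integral_nonneg) auto
  have "quad (Mt t) (?d \<omega>) = 0 \<longleftrightarrow> control G S u t \<omega> = K t *\<^sub>v kalman_est G S u t \<omega>" if om: "\<omega> \<in> space M" for \<omega>
  proof
    assume "quad (Mt t) (?d \<omega>) = 0"
    then have z: "?d \<omega> = 0\<^sub>v (dimu G t)"
      using MM square_integrable_vecD(2)[OF d om] by (force simp: pos_def_def)
    show "control G S u t \<omega> = K t *\<^sub>v kalman_est G S u t \<omega>"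
    proof (rule eq_vecI)
      fix i assume "i < dim_vec (K t *\<^sub>v kalman_est G S u t \<omega>)"
      then have i: "i < dimu G t" using square_integrable_vecD(2)[OF k om] by (simp del: dim_mult_mat_vec)
      have "?d \<omega> $ i = control G S u t \<omega> $ i - (K t *\<^sub>v kalman_est G S u t \<omega>) $ i"
        using i square_integrable_vecD(2)[OF k om] by (intro index_minus_vec) (simp del: dim_mult_mat_vec)
      then show "control G S u t \<omega> $ i = (K t *\<^sub>v kalman_est G S u t \<omega>) $ i"
        using z i by simp
    qed (use square_integrable_vecD(2)[OF k om] square_integrable_vecD(2)[OF c om] in \<open>simp del: dim_mult_mat_vec\<close>)
  next
    assume "control G S u t \<omega> = K t *\<^sub>v kalman_est G S u t \<omega>"
    then have "?d \<omega> = 0\<^sub>v (dimu G t)"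
      using square_integrable_vecD(2)[OF k om] by (simp del: dim_mult_mat_vec)
    then show "quad (Mt t) (?d \<omega>) = 0" using pos_def_carrier(1)[OF MM] by (simp add: quad_def)
  qed
  moreover have "control_gap S u t = 0 \<longleftrightarrow> (AE \<omega> in M. quad (Mt t) (?d \<omega>) = 0)"
    unfolding control_gap_def using nn
    by (intro integral_nonneg_eq_0_iff_AE integral_quad(1)[OF pos_def_carrier(1)[OF MM] d]) auto
  ultimately show "control_gap S u t = 0 \<longleftrightarrow> (AE \<omega> in M. control G S u t \<omega> = K t *\<^sub>v kalman_est G S u t \<omega>)"
    by (simp cong: AE_cong_simp)
qed

text \<open>\<open>p\<close> fixes the error covariances, which by
  \<open>err_cov_policy_independent\<close> are those of every policy of finite cost on
  \<open>S\<close>. So \<open>V\<close> is the same for all of them, and the gaps account for the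
  rest of the cost; an infinite cost satisfies the bound trivially.\<close>

lemma lqg_cost_lower_bound:
  assumes p: "is_policy G S p" "lqg_cost G S p < \<infinity>"
    and V: "V = base_cost + (\<Sum>t=1..T. tr (\<Theta> t * err_cov G S p t))"
  shows "is_policy G S u \<Longrightarrow> ennreal V \<le> lqg_cost G S u"
    and "is_policy G S u \<Longrightarrow> lqg_cost G S u = ennreal V \<longleftrightarrow> kalman_controller G K S u"
    and "0 \<le> V"
proof -
  note sp = square_integrable_policy_if_finite_cost[OF S p]
  have V_eq: "V = base_cost + (\<Sum>t=1..T. tr (\<Theta> t * err_cov G S u t))" if u: "square_integrable_policy S u" for u
  proof -
    have "err_cov G S p t = err_cov G S u t" if "t \<in> {1..T}" for t
      by (rule err_cov_policy_independent[OF S p(1) square_integrable_policyD(1)[OF u] that])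
        (use that in \<open>auto intro!: square_integrable_policyD(3)[OF sp] square_integrable_policyD(3)[OF u]\<close>)
    then show ?thesis unfolding V by simp
  qed
  have gap: "(\<Sum>t=1..T. control_gap S u t) \<ge> 0" if "square_integrable_policy S u" for u
    by (rule sum_nonneg) (rule control_gap_eq_0_iff(1)[OF that])
  have gap0: "(\<Sum>t=1..T. control_gap S u t) = 0 \<longleftrightarrow> kalman_controller G K S u" if u: "square_integrable_policy S u" for u
    using control_gap_eq_0_iff[OF u] square_integrable_policyD(1)[OF u]
    by (subst sum_nonneg_eq_0_iff) (auto simp: kalman_controller_def)
  have cost: "lqg_cost G S u = ennreal (V + (\<Sum>t=1..T. control_gap S u t))"
    and nonneg: "0 \<le> V + (\<Sum>t=1..T. control_gap S u t)" if u: "square_integrable_policy S u" for u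
    unfolding V_eq[OF u] by (rule lqg_cost_eq[OF u])+
  have kal: "square_integrable_policy S u" if "kalman_controller G K S u" for u
    by (rule square_integrable_policy_if_kalman_controller[OF S K_carrier that])
  obtain v where v: "kalman_controller G K S v" using kalman_controller_exists[OF S K_carrier] by blast
  \<comment> \<open>\<open>V\<close> is the real cost of an existing Kalman controller, whose gaps
    vanish.\<close>
  show V0: "0 \<le> V"
    using nonneg[OF kal[OF v]] gap0[OF kal[OF v]] v by simp
  assume u: "is_policy G S u"
  show "ennreal V \<le> lqg_cost G S u"
  proof (cases "lqg_cost G S u < \<infinity>")
    case True
    note su = square_integrable_policy_if_finite_cost[OF S u True]
    show ?thesis unfolding cost[OF su] using gap[OF su] by (intro ennreal_leI) simp
  next
    case False
    then show ?thesis by (simp add: less_top[symmetric])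
  qed
  show "lqg_cost G S u = ennreal V \<longleftrightarrow> kalman_controller G K S u"
  proof
    assume eq: "lqg_cost G S u = ennreal V"
    then have su: "square_integrable_policy S u"
      by (intro square_integrable_policy_if_finite_cost[OF S u]) simp
    \<comment> \<open>Both values are nonnegative, where \<open>ennreal\<close> is
      injective.\<close>
    have "V + (\<Sum>t=1..T. control_gap S u t) = V"
      using eq unfolding cost[OF su] by (simp only: ennreal_inj[OF nonneg[OF su] V0])
    then show "kalman_controller G K S u" using gap0[OF su] by simp
  next
    assume k: "kalman_controller G K S u"
    then show "lqg_cost G S u = ennreal V"
      using gap0[OF kal[OF k]] unfolding cost[OF kal[OF k]] by simp
  qed
qed

end

text \<open>For a centred vector the covariance is the matrix of second moments; a mean
  \<open>m\<close> would add \<open>quad (Nt 1) m\<close>.\<close>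

lemma base_cost_eq:
  assumes "init_mean G = 0\<^sub>v n"
  shows "base_cost = tr (init_cov G * Nt 1) + (\<Sum>t=1..T. tr (proc_cov G t * St t))"
proof -
  have N: "Nt 1 \<in> carrier_mat n n" by (rule pos_semidef_carrier[OF Nt_pos_semidef]) auto
  have V: "init_cov G \<in> carrier_mat n n" using init_gaussian by (simp add: gaussian_vec_def pos_semidef_def)
  note g = init_gaussian[unfolded assms]
  have "expectation (\<lambda>\<omega>. quad (Nt 1) (init_x G \<omega>)) = tr (Nt 1 * init_cov G)"
  proof (rule integral_quad_tr[OF N gaussian_vec_square_integrable[OF g] V])
    show "expectation (\<lambda>\<omega>. init_x G \<omega> $ i * init_x G \<omega> $ j) = init_cov G $$ (j, i)" if "i < n" "j < n" for i j
      using gaussian_vec_second_moment[OF g that(2,1)] by (simp add: mult.commute)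
  qed
  then show ?thesis by (simp only: base_cost_def tr_mult_comm[OF N V])
qed

end

theorem theorem1:
  fixes G :: "('w, 'i) lqg"
    and St Nt Mt K \<Theta> :: "nat \<Rightarrow> real mat"
    and \<pi> :: "'i set \<Rightarrow> 'i policy"
    and \<Sigma> :: "'i set \<Rightarrow> nat \<Rightarrow> real mat"
    and b \<kappa> \<kappa>' :: real
  assumes setting: "lqg_setting G"
    and riccati: "riccati_solution G St Nt Mt K \<Theta>"
    and reference: "\<And>S. S \<subseteq> sensors G \<Longrightarrow> is_policy G S (\<pi> S) \<and> lqg_cost G S (\<pi> S) < \<infinity>"
    and error_covariance: "\<And>S t. \<Sigma> S t = err_cov G S (\<pi> S) t"
    and b: "0 \<le> b"
    and \<kappa>: "0 \<le> \<kappa>"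
    and \<kappa>': "\<kappa>' = \<kappa> - tr (init_cov G * Nt 1) - (\<Sum>t=1..horizon G. tr (proc_cov G t * St t))"
  shows "(\<forall>S u. optimal_budgeted G b S u \<longleftrightarrow> cascade_budgeted G K \<Theta> \<Sigma> b S u)
    \<and> (init_mean G = 0\<^sub>v (dimx G) \<longrightarrow>
        (\<forall>S u. cascade_min_sensing G K \<Theta> \<Sigma> \<kappa>' S u \<longrightarrow> optimal_min_sensing G \<kappa> S u)
      \<and> (\<forall>S u. optimal_min_sensing G \<kappa> S u \<longrightarrow> (\<exists>u'. cascade_min_sensing G K \<Theta> \<Sigma> \<kappa>' S u'))
      \<and> (\<forall>S u. optimal_min_sensing G \<kappa> S u \<and> is_arg_min (lqg_cost G S) (is_policy G S) u
            \<longrightarrow> cascade_min_sensing G K \<Theta> \<Sigma> \<kappa>' S u))"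
proof -
  interpret lqg_riccati G St Nt Mt K \<Theta>
    using setting riccati by unfold_locales
  let ?obj = "sensing_objective G \<Theta> \<Sigma>"
  \<comment> \<open>For admissible sensors, \<open>V S\<close> will be the least cost over all
    policies on \<open>S\<close>, attained exactly by the Kalman controllers.\<close>
  define V where "V S = base_cost + ?obj S" for S
  have V: "V S = base_cost + (\<Sum>t=1..horizon G. tr (\<Theta> t * err_cov G S (\<pi> S) t))" for S
    by (simp add: V_def sensing_objective_def error_covariance)
  have lower: "ennreal (V S) \<le> lqg_cost G S u" and V0: "0 \<le> V S"
    and attained: "lqg_cost G S u = ennreal (V S) \<longleftrightarrow> kalman_controller G K S u"
    if "S \<subseteq> sensors G" "is_policy G S u" for S u
    using lqg_cost_lower_bound[OF that(1) _ _ V] reference[OF that(1)] that(2) by blast+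
  have kal: "\<exists>u. is_policy G S u \<and> kalman_controller G K S u \<and> lqg_cost G S u = ennreal (V S)"
    if "S \<subseteq> sensors G" for S
    using kalman_controller_exists[OF that K_carrier] attained[OF that] by (metis kalman_controller_def)
  have V0: "0 \<le> V S" if "S \<subseteq> sensors G" for S using V0 that reference by blast
  have kalD: "is_policy G S u" "S \<subseteq> sensors G \<Longrightarrow> lqg_cost G S u = ennreal (V S)" if "kalman_controller G K S u" for S u
    using that attained by (auto simp: kalman_controller_def)
  \<comment> \<open>The shared \<open>base_cost\<close> cancels, and \<open>0 \<le> V S\<close>
    turns the comparison in \<open>ennreal\<close> into one of reals.\<close>
  have V_less: "ennreal (V S) < ennreal (V S') \<longleftrightarrow> ?obj S < ?obj S'" if "S \<subseteq> sensors G" "S' \<subseteq> sensors G" for S S'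
    using V0[OF that(1)] by (simp add: ennreal_less_iff V_def)
  have "optimal_budgeted G b S u \<longleftrightarrow> cascade_budgeted G K \<Theta> \<Sigma> b S u" for S u
  proof
    assume o: "optimal_budgeted G b S u"
    then have S: "S \<subseteq> sensors G" "is_policy G S u" "sensing_cost G S \<le> b"
      and min: "\<And>S' u'. S' \<subseteq> sensors G \<Longrightarrow> is_policy G S' u' \<Longrightarrow> sensing_cost G S' \<le> b \<Longrightarrow> lqg_cost G S u \<le> lqg_cost G S' u'"
      by (auto simp: optimal_budgeted_def is_arg_min_def not_less)
    \<comment> \<open>Every admissible sensor set attains its value \<open>V S'\<close>, so the
      optimal cost lies below all of them. Taking \<open>S' = S\<close> forces equality, and with it
      the Kalman controller.\<close>
    have le: "lqg_cost G S u \<le> ennreal (V S')" if "S' \<subseteq> sensors G" "sensing_cost G S' \<le> b" for S'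
      using kal[OF that(1)] min[OF that(1) _ that(2)] by metis
    have eq: "lqg_cost G S u = ennreal (V S)"
      using le[OF S(1,3)] lower[OF S(1,2)] by (rule antisym)
    show "cascade_budgeted G K \<Theta> \<Sigma> b S u"
      using attained[OF S(1,2)] eq S le V_less[OF _ S(1)]
      by (auto simp: cascade_budgeted_def is_arg_min_def not_less[symmetric])
  next
    assume c: "cascade_budgeted G K \<Theta> \<Sigma> b S u"
    then have S: "S \<subseteq> sensors G" "sensing_cost G S \<le> b" and k: "kalman_controller G K S u"
      and min: "\<And>S'. S' \<subseteq> sensors G \<Longrightarrow> sensing_cost G S' \<le> b \<Longrightarrow> \<not> ?obj S' < ?obj S"
      by (auto simp: cascade_budgeted_def is_arg_min_def)
    have "lqg_cost G S u \<le> lqg_cost G S' u'" if "S' \<subseteq> sensors G" "is_policy G S' u'" "sensing_cost G S' \<le> b" for S' u'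
    proof -
      have "ennreal (V S) \<le> ennreal (V S')" using min[OF that(1,3)] V_less[OF that(1) S(1)] by (simp add: not_less)
      then show ?thesis using kalD(2)[OF k S(1)] lower[OF that(1,2)] by simp
    qed
    then show "optimal_budgeted G b S u"
      using S kalD(1)[OF k] by (auto simp: optimal_budgeted_def is_arg_min_def not_less)
  qed
  moreover have "(\<forall>S u. cascade_min_sensing G K \<Theta> \<Sigma> \<kappa>' S u \<longrightarrow> optimal_min_sensing G \<kappa> S u)
      \<and> (\<forall>S u. optimal_min_sensing G \<kappa> S u \<longrightarrow> (\<exists>u'. cascade_min_sensing G K \<Theta> \<Sigma> \<kappa>' S u'))
      \<and> (\<forall>S u. optimal_min_sensing G \<kappa> S u \<and> is_arg_min (lqg_cost G S) (is_policy G S) u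
            \<longrightarrow> cascade_min_sensing G K \<Theta> \<Sigma> \<kappa>' S u)"
    if "init_mean G = 0\<^sub>v (dimx G)"
  proof -
    \<comment> \<open>\<open>\<kappa>'\<close> is \<open>\<kappa>\<close> reduced by the base cost
      in its trace form for a centred initial state.\<close>
    have "V S = ?obj S + (\<kappa> - \<kappa>')" for S
      using base_cost_eq[OF that] \<kappa>' by (simp add: V_def)
    then have V_le: "ennreal (V S) \<le> ennreal \<kappa> \<longleftrightarrow> ?obj S \<le> \<kappa>'" for S
      using \<kappa> by (simp add: ennreal_le_iff)
    have feas: "?obj S \<le> \<kappa>'" if "S \<subseteq> sensors G" "is_policy G S u" "lqg_cost G S u \<le> ennreal \<kappa>" for S u
      using order_trans[OF lower[OF that(1,2)] that(3)] V_le by simp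
    \<comment> \<open>The Kalman controller makes the sensors of the cascade feasible, and by
      \<open>feas\<close> the sensors of every feasible pair compete in the cascade.\<close>
    have A: "optimal_min_sensing G \<kappa> S u" if "cascade_min_sensing G K \<Theta> \<Sigma> \<kappa>' S u" for S u
      using that feas kalD V_le
      by (auto simp: cascade_min_sensing_def optimal_min_sensing_def is_arg_min_def)
    have B: "is_arg_min (sensing_cost G) (\<lambda>S. S \<subseteq> sensors G \<and> ?obj S \<le> \<kappa>') S" if "optimal_min_sensing G \<kappa> S u" for S u
      unfolding is_arg_min_def
    proof (intro conjI notI)
      have S: "S \<subseteq> sensors G" "is_policy G S u" "lqg_cost G S u \<le> ennreal \<kappa>"
        using that by (auto simp: optimal_min_sensing_def is_arg_min_def)
      show "S \<subseteq> sensors G" "?obj S \<le> \<kappa>'" using S feas by auto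
      assume "\<exists>S'. (S' \<subseteq> sensors G \<and> ?obj S' \<le> \<kappa>') \<and> sensing_cost G S' < sensing_cost G S"
      then obtain S' where S': "S' \<subseteq> sensors G" "?obj S' \<le> \<kappa>'" "sensing_cost G S' < sensing_cost G S" by auto
      \<comment> \<open>A cheaper set would be feasible together with its Kalman controller.\<close>
      obtain u' where "is_policy G S' u'" "lqg_cost G S' u' = ennreal (V S')" using kal[OF S'(1)] by blast
      then show False
        using that S' V_le[of S'] by (auto simp: optimal_min_sensing_def is_arg_min_def)
    qed
    \<comment> \<open>Minimality for the given sensors forces the cost \<open>V S\<close> and hence
      the Kalman controller; the bound \<open>\<kappa>\<close> alone does not.\<close>
    have C: "kalman_controller G K S u" if S: "S \<subseteq> sensors G" and u: "is_arg_min (lqg_cost G S) (is_policy G S) u" for S u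
    proof -
      obtain v where "is_policy G S v" "lqg_cost G S v = ennreal (V S)" using kal[OF S] by blast
      with u have "is_policy G S u" "lqg_cost G S u \<le> ennreal (V S)"
        by (auto simp: is_arg_min_def not_less)
      then show ?thesis using attained[OF S] lower[OF S] by (metis antisym)
    qed
    have sub: "S \<subseteq> sensors G" if "optimal_min_sensing G \<kappa> S u" for S u
      using that by (auto simp: optimal_min_sensing_def is_arg_min_def)
    show ?thesis
    proof (intro conjI allI impI)
      fix S u assume o: "optimal_min_sensing G \<kappa> S u"
      \<comment> \<open>The sensors are kept and the controller is replaced by a Kalman
        controller.\<close>
      show "\<exists>u'. cascade_min_sensing G K \<Theta> \<Sigma> \<kappa>' S u'"
        using kal[OF sub[OF o]] B[OF o] unfolding cascade_min_sensing_def by blast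
    next
      fix S u assume o: "optimal_min_sensing G \<kappa> S u \<and> is_arg_min (lqg_cost G S) (is_policy G S) u"
      then show "cascade_min_sensing G K \<Theta> \<Sigma> \<kappa>' S u"
        using B[of S u] C[OF sub[of S u]] unfolding cascade_min_sensing_def by blast
    qed (rule A)
  qed
  ultimately show ?thesis by blast
qed

end
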